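(* Let $G$ be a finite solvable group and let $H$ be a subgroup of $G$. Then the number of maximal subgroups of $G$ which contain $H$ is less than $|H\backslash G/H|$, the number of $(H,H)$-double cosets in $G$.
   Context: A maximal subgroup of $G$ is a proper subgroup not contained in any other proper subgroup. $|H\backslash G/H|$ denotes the number of double cosets $HgH$, $g\in G$. *)

theory Defs
  imports "HOL-Algebra.Algebra"
begin

definition maximal_subgroup :: "'a set \<Rightarrow> ('a, 'b) monoid_scheme \<Rightarrow> bool" where
  "maximal_subgroup M G \<longleftrightarrow>
     subgroup M G \<and> M \<noteq> carrier G \<and>
     (\<forall>K. subgroup K G \<and> K \<noteq> carrier G \<and> M \<subseteq> K \<longrightarrow> K = M)"

definition double_coset :: "('a, 'b) monoid_scheme \<Rightarrow> 'a set \<Rightarrow> 'a \<Rightarrow> 'a set \<Rightarrow> 'a set" where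
  "double_coset G H g K = (H #>\<^bsub>G\<^esub> g) <#>\<^bsub>G\<^esub> K"

definition double_cosets :: "('a, 'b) monoid_scheme \<Rightarrow> 'a set \<Rightarrow> 'a set \<Rightarrow> 'a set set" where
  "double_cosets G H K = (\<lambda>g. double_coset G H g K) ` carrier G"

end

theory Submission
  imports Defs
begin

text \<open>
  The number of double cosets is the dimension of the space of \<open>H\<close>-biinvariant functions on \<open>G\<close>, so it
  suffices to exhibit one more independent function than there are maximal subgroups above \<open>H\<close>.
  By Ore's theorem, non-conjugate maximal subgroups \<open>M\<close>, \<open>L\<close> of a finite solvable group satisfy
  \<open>ML = G\<close>; hence a set invariant under right multiplication by a conjugate of \<open>M\<close> and one invariant under
  a conjugate of \<open>L\<close> are statistically independent in \<open>G\<close>, i.e. their indicator functions are orthogonal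
  modulo constants. So each conjugacy class can be treated separately, modulo constants: the
  conjugates of \<open>M\<close> containing \<open>H\<close> correspond to those \<open>(H,M)\<close>-double cosets that are single left cosets
  of \<open>M\<close>, and the indicators of all double cosets \<open>HgM \<noteq> M\<close> are available. These are too few, by one, only if
  \<open>H\<close> lies in the core of \<open>M\<close>; if \<open>M\<close> is then not normal, the indicator of a suitable right coset \<open>Mg\<close> is added.
  All sets used are disjoint from \<open>H\<close>, so their span misses the indicator of \<open>H\<close>, which makes the
  inequality strict.
\<close>

subsection \<open>Linear algebra\<close>

text \<open>Gaussian elimination, by induction on the equations. If the new equation involves an
  unknown \<open>k\<close>, solving for it costs one equation and one unknown, so the strict
  inequality of the cardinalities survives.\<close>

lemma underdetermined_system_nontrivial_solution:
  fixes v :: "'i \<Rightarrow> 'j \<Rightarrow> real"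
  assumes "finite J" "finite I" "card J < card I"
  shows "\<exists>c. (\<exists>i\<in>I. c i \<noteq> 0) \<and> (\<forall>j\<in>J. (\<Sum>i\<in>I. c i * v i j) = 0)"
  using assms
proof (induction J arbitrary: I v rule: finite_induct)
  case empty
  then have "I \<noteq> {}" by auto
  then show ?case by (intro exI[of _ "\<lambda>_. 1"]) auto
next
  case (insert j J)
  show ?case
  proof (cases "\<forall>i\<in>I. v i j = 0")
    case True
    have "card J < card I" using insert by simp
    from insert.IH[OF insert.prems(1) this] obtain c
      where c: "\<exists>i\<in>I. c i \<noteq> 0" "\<forall>j\<in>J. (\<Sum>i\<in>I. c i * v i j) = 0" by blast
    then show ?thesis using True by (intro exI[of _ c]) auto
  next
    case False
    then obtain k where k: "k \<in> I" "v k j \<noteq> 0" by blast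
    \<comment> \<open>\<open>w\<close> is the system left after solving equation \<open>j\<close>
      for the unknown \<open>k\<close> and substituting; \<open>d\<close> below restores the value
      of that unknown.\<close>
    define w where "w i l = v i l - v i j / v k j * v k l" for i l
    have "finite (I - {k})" "card J < card (I - {k})" using insert k by auto
    from insert.IH[OF this, of w] obtain c
      where c: "\<exists>i\<in>I - {k}. c i \<noteq> 0" "\<forall>l\<in>J. (\<Sum>i\<in>I - {k}. c i * w i l) = 0" by blast
    define d where "d i = (if i = k then - (\<Sum>i\<in>I - {k}. c i * v i j) / v k j else c i)" for i
    have split: "(\<Sum>i\<in>I. d i * v i l) = (\<Sum>i\<in>I - {k}. c i * w i l)" for l
    proof -
      have "(\<Sum>i\<in>I. d i * v i l) = d k * v k l + (\<Sum>i\<in>I - {k}. d i * v i l)"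
        using insert.prems(1) k(1) by (rule sum.remove)
      also have "(\<Sum>i\<in>I - {k}. d i * v i l) = (\<Sum>i\<in>I - {k}. c i * v i l)"
        by (rule sum.cong) (auto simp: d_def)
      also have "d k * v k l = - (\<Sum>i\<in>I - {k}. c i * (v i j / v k j * v k l))"
        by (simp add: d_def sum_distrib_left sum_distrib_right sum_divide_distrib sum_negf mult_ac)
      also have "\<dots> + (\<Sum>i\<in>I - {k}. c i * v i l) = (\<Sum>i\<in>I - {k}. c i * w i l)"
        by (simp add: w_def right_diff_distrib sum_subtractf)
      finally show ?thesis .
    qed
    have "(\<Sum>i\<in>I - {k}. c i * w i j) = 0"
      using k(2) by (simp add: w_def)
    then have "\<forall>l\<in>insert j J. (\<Sum>i\<in>I. d i * v i l) = 0"
      using c(2) by (simp add: split)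
    moreover have "\<exists>i\<in>I. d i \<noteq> 0" using c(1) by (auto simp: d_def)
    ultimately show ?thesis by blast
  qed
qed

text \<open>After subtraction of the means, \<open>orth\<close> says that distinct functions are
  orthogonal. Pairing the vanishing sum with one \<open>s i\<close> kills the centred part of
  \<open>s i\<close>. Hence \<open>s i\<close> is constant on \<open>\<Omega>\<close>, and its zero
  at \<open>x0\<close> determines the constant.\<close>

lemma orthogonal_modulo_constants_sum_eq_0:
  fixes s :: "'i \<Rightarrow> 'x \<Rightarrow> real"
  assumes fin: "finite R" "finite \<Omega>"
    and orth: "\<And>i j. i \<in> R \<Longrightarrow> j \<in> R \<Longrightarrow> i \<noteq> j \<Longrightarrow>
      real (card \<Omega>) * (\<Sum>x\<in>\<Omega>. s i x * s j x) = (\<Sum>x\<in>\<Omega>. s i x) * (\<Sum>x\<in>\<Omega>. s j x)"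
    and zero: "\<And>x. x \<in> \<Omega> \<Longrightarrow> (\<Sum>i\<in>R. s i x) = 0"
    and i: "i \<in> R" and x0: "x0 \<in> \<Omega>" "s i x0 = 0" and x: "x \<in> \<Omega>"
  shows "s i x = 0"
proof -
  define n where "n = real (card \<Omega>)"
  have n: "n > 0" using fin x0 by (auto simp: n_def card_gt_0_iff)
  define T where "T j = (\<Sum>x\<in>\<Omega>. s j x)" for j
  have "(\<Sum>j\<in>R. T j) = (\<Sum>x\<in>\<Omega>. \<Sum>j\<in>R. s j x)"
    unfolding T_def by (rule sum.swap)
  then have "(\<Sum>j\<in>R. T j) = 0" using zero by simp
  then have T: "(\<Sum>j\<in>R - {i}. T j) = - T i"
    using sum.remove[OF fin(1) i, of T] by simp
  have "0 = n * (\<Sum>x\<in>\<Omega>. s i x * (\<Sum>j\<in>R. s j x))" using zero by simp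
  also have "\<dots> = (\<Sum>j\<in>R. n * (\<Sum>x\<in>\<Omega>. s i x * s j x))"
    by (simp add: sum_distrib_left sum.swap[of _ \<Omega>])
  also have "\<dots> = n * (\<Sum>x\<in>\<Omega>. s i x * s i x) + (\<Sum>j\<in>R - {i}. n * (\<Sum>x\<in>\<Omega>. s i x * s j x))"
    using fin(1) i by (rule sum.remove)
  also have "(\<Sum>j\<in>R - {i}. n * (\<Sum>x\<in>\<Omega>. s i x * s j x)) = (\<Sum>j\<in>R - {i}. T i * T j)"
    using orth i by (intro sum.cong) (auto simp: n_def T_def)
  also have "\<dots> = - (T i)\<^sup>2"
    by (simp add: T power2_eq_square flip: sum_distrib_left)
  finally have sq: "n * (\<Sum>x\<in>\<Omega>. (s i x)\<^sup>2) = (T i)\<^sup>2" by (simp add: power2_eq_square)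
  \<comment> \<open>\<open>s i\<close> attains equality in Cauchy--Schwarz against the constants, so it has variance zero.\<close>
  have "(\<Sum>x\<in>\<Omega>. (n * s i x - T i)\<^sup>2) =
      (\<Sum>x\<in>\<Omega>. n * n * (s i x)\<^sup>2 - 2 * n * T i * s i x + (T i)\<^sup>2)"
    by (intro sum.cong) (auto simp: power2_eq_square algebra_simps)
  also have "\<dots> = n * n * (\<Sum>x\<in>\<Omega>. (s i x)\<^sup>2) - 2 * n * T i * (\<Sum>x\<in>\<Omega>. s i x) + n * (T i)\<^sup>2"
    by (simp add: sum.distrib sum_subtractf sum_distrib_left n_def)
  also have "\<dots> = n * (n * (\<Sum>x\<in>\<Omega>. (s i x)\<^sup>2)) - 2 * n * T i * T i + n * (T i)\<^sup>2"
    by (simp add: T_def)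
  also have "\<dots> = 0" unfolding sq by (simp add: power2_eq_square)
  finally have "(n * s i y - T i)\<^sup>2 = 0" if "y \<in> \<Omega>" for y
    using fin(2) that by (subst (asm) sum_nonneg_eq_0_iff) auto
  then have "n * s i y = T i" if "y \<in> \<Omega>" for y using that by fastforce
  from this[OF x0(1)] this[OF x] show ?thesis using n x0(2) by simp
qed

subsection \<open>Factorizations by maximal subgroups\<close>

context group begin

text \<open>An orbit with more than one point has a size dividing a group order whose only possible
  prime divisor is \<open>q\<close>, so \<open>q\<close> divides it. The action is a bare function
  obeying the action laws on \<open>E\<close>, which fits both conjugation and translation of
  cosets.\<close>

lemma dvd_card_if_fixed_point_free:
  assumes fin: "finite (carrier G)" "finite E"
    and q: "Factorial_Ring.prime (q::nat)" "\<And>r. Factorial_Ring.prime r \<Longrightarrow> r dvd order G \<Longrightarrow> r = q"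
    and cl: "\<And>g x. g \<in> carrier G \<Longrightarrow> x \<in> E \<Longrightarrow> \<phi> g x \<in> E"
    and one: "\<And>x. x \<in> E \<Longrightarrow> \<phi> \<one> x = x"
    and mult: "\<And>g h x. g \<in> carrier G \<Longrightarrow> h \<in> carrier G \<Longrightarrow> x \<in> E \<Longrightarrow> \<phi> (g \<otimes> h) x = \<phi> g (\<phi> h x)"
    and free: "\<And>x. x \<in> E \<Longrightarrow> \<exists>g\<in>carrier G. \<phi> g x \<noteq> x"
  shows "q dvd card E"
proof -
  \<comment> \<open>\<open>Bij E\<close> admits only functions that are \<open>undefined\<close>
    outside \<open>E\<close>, hence the restriction.\<close>
  define \<psi> where "\<psi> g = restrict (\<phi> g) E" for g
  have bij: "bij_betw (\<phi> g) E E" if g: "g \<in> carrier G" for g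
  proof (rule bij_betwI[where g = "\<phi> (inv g)"])
    show "\<phi> g \<in> E \<rightarrow> E" "\<phi> (inv g) \<in> E \<rightarrow> E" using g cl by auto
    show "\<phi> (inv g) (\<phi> g x) = x" "\<phi> g (\<phi> (inv g) x) = x" if "x \<in> E" for x
      using mult[of "inv g" g x] mult[of g "inv g" x] g that one by auto
  qed
  then have Bij: "\<psi> g \<in> Bij E" if "g \<in> carrier G" for g
    using that by (auto simp: Bij_def \<psi>_def bij_betw_restrict_eq)
  have "\<psi> \<in> hom G (BijGroup E)"
  proof (rule homI)
    show "\<psi> g \<in> carrier (BijGroup E)" if "g \<in> carrier G" for g
      using Bij[OF that] by (simp add: BijGroup_def)
    show "\<psi> (g \<otimes> h) = \<psi> g \<otimes>\<^bsub>BijGroup E\<^esub> \<psi> h" if "g \<in> carrier G" "h \<in> carrier G" for g h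
      using that Bij[of g] Bij[of h] mult[of g h] cl
      by (auto simp: BijGroup_def \<psi>_def compose_def fun_eq_iff)
  qed
  then interpret group_action G E \<psi>
    using is_group group_BijGroup by (simp add: group_action_def group_hom_def group_hom_axioms_def)
  have "q dvd card orb" if orb: "orb \<in> orbits G E \<psi>" for orb
  proof -
    obtain x where x: "x \<in> E" "orb = orbit G \<psi> x" using orb by (auto simp: orbits_def)
    obtain g where g: "g \<in> carrier G" "\<phi> g x \<noteq> x" using free x by blast
    have "x \<in> orb" "\<phi> g x \<in> orb" using x g orbit_refl by (auto simp: orbit_def \<psi>_def)
    then have "card orb \<noteq> 1" using g by (auto simp: card_1_singleton_iff)
    then obtain r where r: "Factorial_Ring.prime r" "r dvd card orb" using prime_factor_nat by blast
    have "card orb dvd order G"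
      using orbit_stabilizer_theorem[OF x(1)] x(2) by (metis dvd_triv_left)
    with r q(2) show ?thesis using dvd_trans by blast
  qed
  moreover have "card E = (\<Sum>orb\<in>orbits G E \<psi>. card orb)"
    using disjoint_sum[OF fin(2), of "\<lambda>_. 1::nat"] by simp
  ultimately show ?thesis by (simp add: dvd_sum)
qed

text \<open>Sylow with exponent 1 gives a subgroup of order \<open>r\<close>. A nontrivial element
  of it has order dividing both primes.\<close>

lemma prime_dvd_order_imp_exponent:
  assumes "finite (carrier G)" "Factorial_Ring.prime q" "Factorial_Ring.prime (r::nat)" "r dvd order G"
    and "\<And>x. x \<in> carrier G \<Longrightarrow> x [^] (q::nat) = \<one>"
  shows "r = q"
proof -
  obtain m where "order G = r ^ 1 * m" using assms(4) by auto
  then obtain K where K: "subgroup K G" "card K = r ^ 1"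
    using sylow_thm[of r G 1 m] assms is_group by blast
  then have "card K > 1" using assms(3) prime_gt_1_nat by simp
  then obtain x where x: "x \<in> K" "x \<noteq> \<one>"
    by (metis One_nat_def card_1_singleton_iff card_mono finite.emptyI finite_insert is_singletonI
        is_singleton_altdef insert_subset not_less singletonI subsetI card.infinite less_irrefl)
  interpret K: group "G\<lparr>carrier := K\<rparr>" using K(1) subgroup.subgroup_is_group is_group by blast
  have "x [^] r = \<one>"
    using K.pow_order_eq_1[of x] x(1) K by (simp add: order_def flip: nat_pow_consistent)
  moreover have xc: "x \<in> carrier G" using K(1) x(1) subgroup.subset by blast
  ultimately have "ord x dvd r" "ord x dvd q" using assms(5) by (auto simp: pow_eq_id)
  moreover have "ord x \<noteq> 1" using ord_eq_1[OF xc] x(2) by simp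
  ultimately show ?thesis using assms(2,3) by (metis prime_nat_iff)
qed


section \<open>Conjugation and normality\<close>

lemma inv_mult_cancel [simp]:
  assumes "x \<in> carrier G" "y \<in> carrier G"
  shows "inv x \<otimes> (x \<otimes> y) = y" "x \<otimes> (inv x \<otimes> y) = y"
  using assms by (simp_all add: m_assoc[symmetric])

text \<open>Conjugation by \<open>n \<otimes> m\<close> is conjugation by \<open>m\<close> followed
  by conjugation by \<open>n\<close>, so normality in a factorized group splits into one check per
  factor.\<close>

lemma normal_if_factors_normalize:
  assumes C: "subgroup C G" and "N \<subseteq> carrier G" "M \<subseteq> carrier G"
    and fac: "\<And>x. x \<in> carrier G \<Longrightarrow> \<exists>n\<in>N. \<exists>m\<in>M. x = n \<otimes> m"
    and N: "\<And>n c. n \<in> N \<Longrightarrow> c \<in> C \<Longrightarrow> n \<otimes> c \<otimes> inv n \<in> C"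
    and M: "\<And>m c. m \<in> M \<Longrightarrow> c \<in> C \<Longrightarrow> m \<otimes> c \<otimes> inv m \<in> C"
  shows "C \<lhd> G"
proof (rule normal_invI[OF C])
  fix x c assume x: "x \<in> carrier G" and c: "c \<in> C"
  obtain n m where nm: "n \<in> N" "m \<in> M" "x = n \<otimes> m" using fac[OF x] by blast
  have "n \<in> carrier G" "m \<in> carrier G" "c \<in> carrier G"
    using nm assms c subgroup.subset by blast+
  then have "x \<otimes> c \<otimes> inv x = n \<otimes> (m \<otimes> c \<otimes> inv m) \<otimes> inv n"
    by (simp add: nm m_assoc inv_mult_group)
  then show "x \<otimes> c \<otimes> inv x \<in> C" using N M nm c by simp
qed

lemma conj_nat_pow:
  assumes "g \<in> carrier G" "x \<in> carrier G"
  shows "(g \<otimes> x \<otimes> inv g) [^] (n::nat) = g \<otimes> x [^] n \<otimes> inv g"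
proof (induction n)
  case (Suc n)
  have "(g \<otimes> x [^] n \<otimes> inv g) \<otimes> (g \<otimes> x \<otimes> inv g) = g \<otimes> x [^] n \<otimes> (inv g \<otimes> g) \<otimes> x \<otimes> inv g"
    using assms by (simp add: m_assoc)
  then show ?case using Suc assms by (simp add: m_assoc)
qed (use assms in simp)

lemma conj_eq_self_iff:
  assumes "g \<in> carrier G" "x \<in> carrier G"
  shows "g \<otimes> x \<otimes> inv g = x \<longleftrightarrow> g \<otimes> x = x \<otimes> g"
  using assms by (metis inv_solve_right m_closed)

section \<open>Abelian normal subgroups of solvable groups\<close>

lemma solvable_has_abelian_normal:
  assumes "solvable G" "carrier G \<noteq> {\<one>}"
  obtains D where "D \<lhd> G" "D \<noteq> {\<one>}" "\<And>x y. x \<in> D \<Longrightarrow> y \<in> D \<Longrightarrow> x \<otimes> y = y \<otimes> x"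
proof -
  let ?P = "\<lambda>n. (derived G ^^ n) (carrier G) = {\<one>}"
  define n where "n = (LEAST n. ?P n)"
  have P: "?P n" unfolding n_def
    using assms(1) solvable_iff_trivial_derived_seq by (metis (mono_tags, lifting) LeastI_ex)
  then obtain m where m: "n = Suc m" using assms(2) by (cases n) auto
  \<comment> \<open>The last nontrivial term of the derived series: its own derived subgroup is
    trivial, so it is abelian.\<close>
  define D where "D = (derived G ^^ m) (carrier G)"
  have "(derived G ^^ k) (carrier G) \<lhd> G" for k
    by (induction k) (auto simp: normal_self derived_is_normal)
  then have D: "D \<lhd> G" by (simp add: D_def)
  then have sub: "D \<subseteq> carrier G" using normal_imp_subgroup subgroup.subset by blast
  have "\<not> ?P m" using m not_less_Least[of m ?P] n_def by auto
  moreover have "x \<otimes> y = y \<otimes> x" if xy: "x \<in> D" "y \<in> D" for x y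
  proof -
    have "x \<otimes> y \<otimes> inv x \<otimes> inv y \<in> derived G D"
      unfolding derived_def by (rule generate.incl) (use xy in blast)
    also have "derived G D = {\<one>}" using P by (simp add: D_def m)
    finally have "x \<otimes> y \<otimes> inv x \<otimes> inv y = \<one>" by simp
    moreover have "x \<in> carrier G" "y \<in> carrier G" using xy sub by auto
    ultimately show ?thesis
      by (metis inv_closed inv_equality inv_inv inv_solve_right m_closed l_one)
  qed
  ultimately show ?thesis using that D by (simp add: D_def)
qed

text \<open>In an abelian normal subgroup the elements killed by \<open>q\<close> form a subgroup,
  and conjugation preserves it because it commutes with powers. If \<open>q\<close> divides the
  order \<open>q * k\<close> of some \<open>x\<close>, then \<open>x [^] k\<close> is a nontrivial
  member.\<close>

lemma solvable_has_elementary_abelian_normal: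
  assumes fin: "finite (carrier G)" and "solvable G" "carrier G \<noteq> {\<one>}"
  obtains A q where "A \<lhd> G" "A \<noteq> {\<one>}" "\<And>x y. x \<in> A \<Longrightarrow> y \<in> A \<Longrightarrow> x \<otimes> y = y \<otimes> x"
    "Factorial_Ring.prime (q::nat)" "\<And>x. x \<in> A \<Longrightarrow> x [^] q = \<one>"
proof -
  obtain D where D: "D \<lhd> G" "D \<noteq> {\<one>}" "\<And>x y. x \<in> D \<Longrightarrow> y \<in> D \<Longrightarrow> x \<otimes> y = y \<otimes> x"
    using solvable_has_abelian_normal assms by blast
  interpret D: normal D G by fact
  obtain x where x: "x \<in> D" "x \<noteq> \<one>" using D(2) D.one_closed by blast
  then have xc: "x \<in> carrier G" using D.subset by blast
  have "ord x \<noteq> 1" using x xc ord_eq_1 by simp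
  then obtain q where q: "Factorial_Ring.prime q" "q dvd ord x" using prime_factor_nat by blast
  then obtain k where k: "ord x = q * k" by auto
  define A where "A = {y \<in> D. y [^] q = \<one>}"
  have "subgroup A G"
  proof (rule subgroupI)
    have "\<one> \<in> A" by (simp add: A_def)
    then show "A \<noteq> {}" by blast
    show "A \<subseteq> carrier G" using D.subset by (auto simp: A_def)
    show "inv a \<in> A" if "a \<in> A" for a
      using that D.subset by (auto simp: A_def nat_pow_inv)
    show "a \<otimes> b \<in> A" if "a \<in> A" "b \<in> A" for a b
      using that D.subset D(3) by (auto simp: A_def pow_mult_distrib)
  qed
  then have "A \<lhd> G"
    using D.inv_op_closed2 D.subset by (intro normal_invI) (auto simp: A_def conj_nat_pow)
  moreover have "x [^] k \<in> A"
  proof -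
    have "x [^] k \<in> D" using x(1)
      by (induction k) auto
    moreover have "(x [^] k) [^] q = \<one>" using xc pow_ord_eq_1[OF xc]
      by (simp add: nat_pow_pow k mult.commute)
    ultimately show ?thesis by (simp add: A_def)
  qed
  moreover have "x [^] k \<noteq> \<one>"
  proof
    assume "x [^] k = \<one>"
    then have "q * k dvd k" using xc k by (simp add: pow_eq_id)
    moreover have "k > 0" using ord_ge_1[OF fin xc] k by (cases k) auto
    ultimately show False using q(1) prime_gt_1_nat[OF q(1)] by (auto dest: dvd_imp_le)
  qed
  ultimately show ?thesis
  proof (intro that[of A q])
    show "x \<otimes> y = y \<otimes> x" if "x \<in> A" "y \<in> A" for x y
      using that by (intro D(3)) (auto simp: A_def)
    show "x [^] q = \<one>" if "x \<in> A" for x using that by (simp add: A_def)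
  qed (use q(1) in auto)
qed

section \<open>Supplements and complements of normal subgroups\<close>

lemma maximal_normal_factor:
  assumes M: "maximal_subgroup M G" and N: "N \<lhd> G" "\<not> N \<subseteq> M" and x: "x \<in> carrier G"
  shows "\<exists>n\<in>N. \<exists>m\<in>M. x = n \<otimes> m"
proof -
  interpret second_isomorphism_grp N G M
    using N(1) M by (simp add: second_isomorphism_grp_def second_isomorphism_grp_axioms_def
      maximal_subgroup_def)
  \<comment> \<open>The product is a subgroup that contains \<open>M\<close> properly, so maximality
    leaves only the whole group.\<close>
  have "N <#> M = carrier G"
    using M N(2) normal_set_mult_subgroup H_contained_in_set_mult S_contained_in_set_mult
    unfolding maximal_subgroup_def by blast
  then have "x \<in> N <#> M" using x by simp
  then show ?thesis by (auto simp: set_mult_def)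
qed

text \<open>The map sending \<open>n\<close> to \<open>L #> n\<close> is a bijection from
  \<open>N\<close>: trivial intersection makes it injective, and normality rewrites
  \<open>n \<otimes> l\<close> as \<open>l\<close> times a conjugate of \<open>n\<close>, which
  makes it surjective.\<close>

lemma card_rcosets_complement:
  assumes N: "N \<lhd> G" and L: "subgroup L G" "N \<inter> L = {\<one>}"
    and fac: "\<And>x. x \<in> carrier G \<Longrightarrow> \<exists>n\<in>N. \<exists>l\<in>L. x = n \<otimes> l"
  shows "card (rcosets L) = card N"
proof -
  interpret N: normal N G by fact
  have "bij_betw (\<lambda>n. L #> n) N (rcosets L)"
  proof (rule bij_betw_imageI)
    show "inj_on (\<lambda>n. L #> n) N"
    proof (rule inj_onI)
      fix n k assume nk: "n \<in> N" "k \<in> N" "L #> n = L #> k"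
      then have c: "n \<in> carrier G" "k \<in> carrier G" using N.subset by auto
      have "n \<in> L #> k" using nk(3) rcos_self[OF c(1) L(1)] by simp
      then have "n \<otimes> inv k \<in> L" using subgroup.rcos_module_imp[OF L(1) is_group c(2)] by blast
      moreover have "n \<otimes> inv k \<in> N" using nk by simp
      ultimately have "n \<otimes> inv k = \<one>" using L(2) by blast
      then show "n = k" using c by (metis inv_equality inv_inv inv_closed)
    qed
    have "L #> x \<in> (\<lambda>n. L #> n) ` N" if x: "x \<in> carrier G" for x
    proof -
      obtain n l where nl: "n \<in> N" "l \<in> L" "x = n \<otimes> l" using fac[OF x] by blast
      then have c: "n \<in> carrier G" "l \<in> carrier G" using N.subset L(1) subgroup.subset by auto
      have k: "inv l \<otimes> n \<otimes> l \<in> N" using N.inv_op_closed1[OF c(2) nl(1)] .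
      have "x = l \<otimes> (inv l \<otimes> n \<otimes> l)" using c nl by (simp add: m_assoc[symmetric])
      then have "x \<in> L #> (inv l \<otimes> n \<otimes> l)" using nl(2) by (auto simp: r_coset_def)
      then have "L #> x = L #> (inv l \<otimes> n \<otimes> l)"
        using repr_independence[OF _ _ L(1)] k N.subset by (metis subsetD)
      then show ?thesis using k by blast
    qed
    then show "(\<lambda>n. L #> n) ` N = rcosets L"
      using N.subset by (auto simp: RCOSETS_def)
  qed
  then show ?thesis by (metis bij_betw_same_card)
qed


text \<open>Exponent \<open>q\<close> leaves \<open>q\<close> as the only prime that can divide the
  order of \<open>A\<close>, so the orbit count applies to \<open>A\<close> as a group in its own
  right.\<close>

lemma elementary_dvd_card_if_fixed_point_free:
  assumes A: "subgroup A G" "finite A"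
    and q: "Factorial_Ring.prime (q::nat)" "\<And>x. x \<in> A \<Longrightarrow> x [^] q = \<one>"
    and "finite E"
    and "\<And>g x. g \<in> A \<Longrightarrow> x \<in> E \<Longrightarrow> \<phi> g x \<in> E"
    and "\<And>x. x \<in> E \<Longrightarrow> \<phi> \<one> x = x"
    and "\<And>g h x. g \<in> A \<Longrightarrow> h \<in> A \<Longrightarrow> x \<in> E \<Longrightarrow> \<phi> (g \<otimes> h) x = \<phi> g (\<phi> h x)"
    and "\<And>x. x \<in> E \<Longrightarrow> \<exists>g\<in>A. \<phi> g x \<noteq> x"
  shows "q dvd card E"
proof -
  interpret A: group "G\<lparr>carrier := A\<rparr>" using A(1) subgroup.subgroup_is_group is_group by blast
  have "r = q" if "Factorial_Ring.prime r" "r dvd order (G\<lparr>carrier := A\<rparr>)" for r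
    using A.prime_dvd_order_imp_exponent[OF _ q(1) that] q(2) A(2)
    by (simp flip: nat_pow_consistent)
  then show ?thesis
    using A.dvd_card_if_fixed_point_free[of E q \<phi>] assms by simp
qed

text \<open>
  \<open>M\<close> and \<open>L\<close> are complements of an abelian normal subgroup \<open>N\<close>. An elementary abelian \<open>q\<close>-subgroup \<open>A\<close>
  normal in \<open>M\<close> acts on \<open>N\<close> with trivial fixed points, so \<open>q\<close> does not divide \<open>|N| = |G : L|\<close>. Hence \<open>A\<close>
  fixes a coset of \<open>L\<close>, i.e. lies in a conjugate of \<open>L\<close>, and \<open>M\<close> and this conjugate both
  equal the normalizer of \<open>A\<close>. This avoids Sylow and Schur--Zassenhaus conjugacy.
\<close>

lemma maximal_conj_or_factor_if_core_trivial:
  assumes fin: "finite (carrier G)" and sol: "solvable G"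
    and M: "maximal_subgroup M G" and L: "maximal_subgroup L G"
    and core: "\<And>C. C \<lhd> G \<Longrightarrow> C \<subseteq> M \<Longrightarrow> C \<subseteq> L \<Longrightarrow> C = {\<one>}"
  shows "(\<exists>g\<in>carrier G. M = (\<lambda>x. g \<otimes> x \<otimes> inv g) ` L) \<or> M <#> L = carrier G"
proof (rule disjCI)
  assume nprod: "M <#> L \<noteq> carrier G"
  have Ms: "subgroup M G" "M \<noteq> carrier G" and Ls: "subgroup L G" "L \<noteq> carrier G"
    using M L by (auto simp: maximal_subgroup_def)
  have MLc: "M \<subseteq> carrier G" "L \<subseteq> carrier G" using Ms Ls subgroup.subset by auto
  \<comment> \<open>A normal subgroup \<open>C\<close> inside \<open>M\<close> but not inside
    \<open>L\<close> would give \<open>CL = G\<close> and thus \<open>ML = G\<close>. So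
    \<open>C\<close> lies in both, and \<open>core\<close> applies.\<close>
  have coreM: "C = {\<one>}" if C: "C \<lhd> G" "C \<subseteq> M" for C
  proof (cases "C \<subseteq> L")
    case False
    have "carrier G \<subseteq> M <#> L"
      using maximal_normal_factor[OF L C(1) False] C(2) by (fastforce simp: set_mult_def)
    then show ?thesis using nprod setmult_subset_G[OF MLc] by blast
  qed (use core C in blast)
  have coreL: "C = {\<one>}" if C: "C \<lhd> G" "C \<subseteq> L" for C
  proof (cases "C \<subseteq> M")
    case False
    \<comment> \<open>Here \<open>G = CM\<close> has its factors in the wrong order; decomposing
      \<open>inv x\<close> in place of \<open>x\<close> reverses them.\<close>
    have "x \<in> M <#> L" if x: "x \<in> carrier G" for x
    proof -
      obtain c m where cm: "c \<in> C" "m \<in> M" "inv x = c \<otimes> m"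
        using maximal_normal_factor[OF M C(1) False] x by (metis inv_closed)
      then have "x = inv m \<otimes> inv c"
        using x C(2) MLc by (metis inv_inv inv_mult_group subsetD)
      moreover have "inv m \<in> M" "inv c \<in> L"
        using cm C(2) Ms Ls by (auto intro: subgroup.m_inv_closed)
      ultimately show ?thesis by (auto simp: set_mult_def)
    qed
    then show ?thesis using nprod setmult_subset_G[OF MLc] by blast
  qed (use core C in blast)
  have "carrier G \<noteq> {\<one>}" using Ms(2) MLc(1) subgroup.one_closed[OF Ms(1)] by auto
  then obtain N where N: "N \<lhd> G" "N \<noteq> {\<one>}" "\<And>x y. x \<in> N \<Longrightarrow> y \<in> N \<Longrightarrow> x \<otimes> y = y \<otimes> x"
    using solvable_has_abelian_normal sol by blast
  interpret N: normal N G by fact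
  have NM: "\<exists>n\<in>N. \<exists>m\<in>M. x = n \<otimes> m" if "x \<in> carrier G" for x
    using maximal_normal_factor[OF M N(1) _ that] coreM[OF N(1)] N(2) by blast
  have NL: "\<exists>n\<in>N. \<exists>m\<in>L. x = n \<otimes> m" if "x \<in> carrier G" for x
    using maximal_normal_factor[OF L N(1) _ that] coreL[OF N(1)] N(2) by blast
  \<comment> \<open>\<open>N\<close>, being abelian, centralizes \<open>N \<inter> K\<close>, and
    \<open>K\<close> normalizes it. It is therefore normal in \<open>G = NK\<close> and lies in
    \<open>K\<close>, where only the trivial subgroup is normal in \<open>G\<close>.\<close>
  have trivial_int: "N \<inter> K = {\<one>}"
    if K: "subgroup K G" and NK: "\<And>x. x \<in> carrier G \<Longrightarrow> \<exists>n\<in>N. \<exists>m\<in>K. x = n \<otimes> m"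
      and coreK: "\<And>C. C \<lhd> G \<Longrightarrow> C \<subseteq> K \<Longrightarrow> C = {\<one>}" for K
  proof (rule coreK)
    show "N \<inter> K \<lhd> G"
    proof (rule normal_if_factors_normalize[OF _ _ _ NK])
      show "subgroup (N \<inter> K) G" using K N.is_subgroup subgroups_Inter_pair by blast
      show "N \<subseteq> carrier G" "K \<subseteq> carrier G" using N.subset K subgroup.subset by auto
      show "n \<otimes> c \<otimes> inv n \<in> N \<inter> K" if "n \<in> N" "c \<in> N \<inter> K" for n c
        using that conj_eq_self_iff[of n c] N(3)[of n c] N.subset by auto
      show "m \<otimes> c \<otimes> inv m \<in> N \<inter> K" if "m \<in> K" "c \<in> N \<inter> K" for m c
        using that N.inv_op_closed2[of m c] subgroup.subset[OF K]
        by (auto simp: subgroup.m_closed[OF K] subgroup.m_inv_closed[OF K])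
    qed
  qed simp
  have NMi: "N \<inter> M = {\<one>}" using trivial_int[OF Ms(1) NM coreM] by blast
  have NLi: "N \<inter> L = {\<one>}" using trivial_int[OF Ls(1) NL coreL] by blast
  show "\<exists>g\<in>carrier G. M = (\<lambda>x. g \<otimes> x \<otimes> inv g) ` L"
  proof (cases "M = {\<one>}")
    case True
    \<comment> \<open>With \<open>M\<close> trivial, \<open>N\<close> is everything, so its
      complement \<open>L\<close> is trivial as well.\<close>
    have "carrier G \<subseteq> N" using NM True N.subset by fastforce
    then have "L = {\<one>}" using NLi MLc by blast
    then show ?thesis using True by (intro bexI[of _ \<one>]) auto
  next
    case False
    interpret M: group "G\<lparr>carrier := M\<rparr>" using Ms(1) subgroup.subgroup_is_group is_group by blast
    have finM: "finite M" using fin MLc finite_subset by blast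
    have "group_hom (G\<lparr>carrier := M\<rparr>) G (\<lambda>x. x)"
      using MLc by (auto simp: group_hom_def group_hom_axioms_def hom_def is_group M.is_group)
    then have "solvable (G\<lparr>carrier := M\<rparr>)"
      using group_hom.inj_hom_imp_solvable sol by fastforce
    from M.solvable_has_elementary_abelian_normal[OF _ this] obtain A q where
      A: "A \<lhd> G\<lparr>carrier := M\<rparr>" "A \<noteq> {\<one>}" "\<And>x y. x \<in> A \<Longrightarrow> y \<in> A \<Longrightarrow> x \<otimes> y = y \<otimes> x"
      and q: "Factorial_Ring.prime (q::nat)" "\<And>x. x \<in> A \<Longrightarrow> x [^] q = \<one>"
      using False finM by (auto simp flip: nat_pow_consistent)
    have As: "subgroup A G" and AM: "A \<subseteq> M"
      using incl_subgroup[OF Ms(1) normal_imp_subgroup[OF A(1)]]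
        subgroup.subset[OF normal_imp_subgroup[OF A(1)]] by auto
    have Ac: "A \<subseteq> carrier G" using AM MLc by blast
    have normA: "m \<otimes> a \<otimes> inv m \<in> A" if "m \<in> M" "a \<in> A" for m a
      using M.normal_invE(2)[OF A(1), of m a] that Ms(1) by (simp add: m_inv_consistent)
    have finA: "finite A" "finite N" using fin Ac N.subset finite_subset by auto
    \<comment> \<open>The centralizer of \<open>A\<close> in \<open>N\<close>, that is, the fixed
      points of \<open>A\<close> acting on \<open>N\<close> by conjugation. \<open>M\<close>
      normalizes it because \<open>M\<close> normalizes \<open>A\<close>.\<close>
    define C where "C = {n \<in> N. \<forall>a\<in>A. a \<otimes> n = n \<otimes> a}"
    have "subgroup C G"
    proof (rule subgroupI)
      show "C \<subseteq> carrier G" using N.subset by (auto simp: C_def)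
      have "\<one> \<in> C" using Ac by (auto simp: C_def)
      then show "C \<noteq> {}" by blast
      show "inv c \<in> C" if "c \<in> C" for c
      proof -
        have "a \<otimes> inv c = inv c \<otimes> a" if "a \<in> A" for a
        proof -
          have ac: "a \<in> carrier G" "c \<in> carrier G" "a \<otimes> c = c \<otimes> a"
            using \<open>c \<in> C\<close> that Ac N.subset by (auto simp: C_def)
          have "inv c \<otimes> (a \<otimes> c) \<otimes> inv c = inv c \<otimes> (c \<otimes> a) \<otimes> inv c" using ac(3) by simp
          then show ?thesis using ac(1,2) by (simp add: m_assoc)
        qed
        then show ?thesis using that by (simp add: C_def)
      qed
      show "c \<otimes> d \<in> C" if cd: "c \<in> C" "d \<in> C" for c d
      proof -
        have "a \<otimes> (c \<otimes> d) = c \<otimes> d \<otimes> a" if a: "a \<in> A" for a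
        proof -
          have "c \<in> carrier G" "d \<in> carrier G" "a \<in> carrier G"
            using cd a Ac N.subset by (auto simp: C_def)
          moreover have "a \<otimes> c = c \<otimes> a" "a \<otimes> d = d \<otimes> a" using cd a by (auto simp: C_def)
          ultimately show ?thesis by (metis m_assoc)
        qed
        then show ?thesis using cd by (simp add: C_def)
      qed
    qed
    then have C: "C \<lhd> G"
    proof (rule normal_if_factors_normalize[OF _ _ _ NM])
      show "N \<subseteq> carrier G" "M \<subseteq> carrier G" using N.subset MLc by auto
      show "n \<otimes> c \<otimes> inv n \<in> C" if "n \<in> N" "c \<in> C" for n c
        using that conj_eq_self_iff[of n c] N(3)[of n c] N.subset by (auto simp: C_def)
      show "m \<otimes> c \<otimes> inv m \<in> C" if m: "m \<in> M" and c: "c \<in> C" for m c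
      proof -
        have mc: "m \<in> carrier G" "c \<in> carrier G" using m c MLc N.subset by (auto simp: C_def)
        have "a \<otimes> (m \<otimes> c \<otimes> inv m) = m \<otimes> c \<otimes> inv m \<otimes> a" if a: "a \<in> A" for a
        proof -
          have ac: "a \<in> carrier G" using a Ac by blast
          have "inv m \<otimes> a \<otimes> m \<in> A"
            using normA[of "inv m" a] m a mc subgroup.m_inv_closed[OF Ms(1)] by simp
          then have "(inv m \<otimes> a \<otimes> m) \<otimes> c = c \<otimes> (inv m \<otimes> a \<otimes> m)" using c by (simp add: C_def)
          then have "m \<otimes> ((inv m \<otimes> a \<otimes> m) \<otimes> c) \<otimes> inv m = m \<otimes> (c \<otimes> (inv m \<otimes> a \<otimes> m)) \<otimes> inv m"
            by simp
          then show ?thesis using mc ac by (simp add: m_assoc)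
        qed
        moreover have "m \<otimes> c \<otimes> inv m \<in> N" using c mc N.inv_op_closed2 by (simp add: C_def)
        ultimately show ?thesis by (simp add: C_def)
      qed
    qed
    \<comment> \<open>Otherwise \<open>G = CM\<close>, and \<open>N \<inter> M = {\<one>}\<close>
      forces \<open>N = C\<close>. Then \<open>N\<close> centralizes \<open>A\<close> while
      \<open>M\<close> normalizes it, so \<open>A\<close> is a nontrivial normal subgroup of
      \<open>G\<close> inside \<open>M\<close>.\<close>
    have C1: "C = {\<one>}"
    proof (rule ccontr)
      assume "C \<noteq> {\<one>}"
      then have CM: "\<not> C \<subseteq> M" using coreM C by blast
      have "N \<subseteq> C"
      proof
        fix n assume n: "n \<in> N"
        then obtain c m where cm: "c \<in> C" "m \<in> M" "n = c \<otimes> m"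
          using maximal_normal_factor[OF M C CM] N.subset by blast
        then have "c \<in> N" "c \<in> carrier G" "m \<in> carrier G" using N.subset MLc by (auto simp: C_def)
        moreover from this have "m = inv c \<otimes> n" using cm by simp
        ultimately have "m \<in> N" using n by simp
        then have "m = \<one>" using NMi cm(2) by blast
        then show "n \<in> C" using cm \<open>c \<in> carrier G\<close> by simp
      qed
      have "A \<lhd> G"
      proof (rule normal_if_factors_normalize[OF As N.subset MLc(1) NM])
        show "n \<otimes> a \<otimes> inv n \<in> A" if "n \<in> N" "a \<in> A" for n a
        proof -
          have "a \<otimes> n = n \<otimes> a" using \<open>N \<subseteq> C\<close> that by (auto simp: C_def)
          then show ?thesis using that conj_eq_self_iff[of n a] Ac N.subset by auto
        qed
      qed (use normA in auto)
      then show False using coreM AM A(2) by blast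
    qed
    have q1: "q dvd card (N - {\<one>})"
    proof (rule elementary_dvd_card_if_fixed_point_free[OF As finA(1) q])
      show "finite (N - {\<one>})" using finA by simp
      show "a \<otimes> x \<otimes> inv a \<in> N - {\<one>}" if "a \<in> A" "x \<in> N - {\<one>}" for a x
      proof -
        have c: "a \<in> carrier G" "x \<in> carrier G" using that Ac N.subset by auto
        have "a \<otimes> x \<otimes> inv a \<noteq> \<one>"
        proof
          assume "a \<otimes> x \<otimes> inv a = \<one>"
          then have "inv a \<otimes> (a \<otimes> x \<otimes> inv a) \<otimes> a = inv a \<otimes> \<one> \<otimes> a" by simp
          then show False using that c by (simp add: m_assoc)
        qed
        then show ?thesis using that c N.inv_op_closed2 by simp
      qed
      show "\<one> \<otimes> x \<otimes> inv \<one> = x" if "x \<in> N - {\<one>}" for x using that N.subset by auto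
      show "g \<otimes> h \<otimes> x \<otimes> inv (g \<otimes> h) = g \<otimes> (h \<otimes> x \<otimes> inv h) \<otimes> inv g"
        if "g \<in> A" "h \<in> A" "x \<in> N - {\<one>}" for g h x
      proof -
        have "g \<in> carrier G" "h \<in> carrier G" "x \<in> carrier G" using that Ac N.subset by auto
        then show ?thesis by (simp add: m_assoc inv_mult_group)
      qed
      show "\<exists>a\<in>A. a \<otimes> x \<otimes> inv a \<noteq> x" if x: "x \<in> N - {\<one>}" for x
      proof -
        have "x \<notin> C" using x C1 by blast
        then obtain a where "a \<in> A" "a \<otimes> x \<noteq> x \<otimes> a" using x by (auto simp: C_def)
        then show ?thesis using conj_eq_self_iff[of a x] x Ac N.subset by blast
      qed
    qed
    have "\<not> q dvd card (rcosets L)"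
    proof
      assume "q dvd card (rcosets L)"
      \<comment> \<open>The index of \<open>L\<close> equals the size of \<open>N\<close>, which is
        congruent to 1 modulo \<open>q\<close> since only the identity is fixed.\<close>
      then have "q dvd Suc (card (N - {\<one>}))"
        using card_rcosets_complement[OF N(1) Ls(1) NLi NL] card_Suc_Diff1[OF finA(2) N.one_closed]
        by simp
      then have "q dvd 1" using q1 dvd_add_right_iff[of q "card (N - {\<one>})" 1] by simp
      then show False using q(1) not_prime_unit by blast
    qed
    then have "\<exists>U\<in>rcosets L. \<forall>a\<in>A. U #> inv a = U"
    proof (rule contrapos_np)
      assume nofix: "\<not> (\<exists>U\<in>rcosets L. \<forall>a\<in>A. U #> inv a = U)"
      have rc: "U \<subseteq> carrier G" if "U \<in> rcosets L" for U
        using subgroup.rcosets_carrier[OF Ls(1) is_group that] .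
      \<comment> \<open>Translation by \<open>inv a\<close>, not \<open>a\<close>, turns right
        multiplication into a left action. A fixed coset \<open>L #> g\<close> will mean that
        \<open>g\<close> conjugates \<open>A\<close> into \<open>L\<close>.\<close>
      show "q dvd card (rcosets L)"
      proof (rule elementary_dvd_card_if_fixed_point_free[OF As finA(1) q,
            where \<phi> = "\<lambda>a U. U #> inv a"])
        show "finite (rcosets L)"
          using fin rcosets_subset_PowG[OF Ls(1)] by (meson finite_Pow_iff finite_subset)
        show "U #> inv a \<in> rcosets L" if "a \<in> A" "U \<in> rcosets L" for a U
        proof -
          obtain x where x: "x \<in> carrier G" "U = L #> x" using \<open>U \<in> rcosets L\<close> by (auto simp: RCOSETS_def)
          then have "U #> inv a = L #> (x \<otimes> inv a)"
            using \<open>a \<in> A\<close> Ac MLc by (simp add: coset_mult_assoc subset_iff)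
          then show ?thesis using x \<open>a \<in> A\<close> Ac MLc(2) by (simp add: rcosetsI subset_iff)
        qed
        show "U #> inv \<one> = U" if "U \<in> rcosets L" for U
          using rc[OF that] by simp
        show "U #> inv (g \<otimes> h) = U #> inv h #> inv g"
          if "g \<in> A" "h \<in> A" "U \<in> rcosets L" for g h U
        proof -
          have "g \<in> carrier G" "h \<in> carrier G" using that Ac by auto
          then show ?thesis using rc[OF that(3)] by (simp add: coset_mult_assoc inv_mult_group)
        qed
        show "\<exists>g\<in>A. U #> inv g \<noteq> U" if "U \<in> rcosets L" for U
          using nofix that by auto
      qed
    qed
    then obtain g where g: "g \<in> carrier G" "\<And>a. a \<in> A \<Longrightarrow> L #> g #> inv a = L #> g"
      by (auto simp: RCOSETS_def)
    have conjA: "g \<otimes> a \<otimes> inv g \<in> L" if a: "a \<in> A" for a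
    proof -
      have ac: "a \<in> carrier G" using a Ac by blast
      have "inv a \<in> A" using a As by (simp add: subgroup.m_inv_closed)
      from g(2)[OF this] have "L #> (g \<otimes> a) = L #> g" using ac g(1) MLc by (simp add: coset_mult_assoc)
      then have "g \<otimes> a \<in> L #> g" using rcos_self[of "g \<otimes> a" L] ac g(1) Ls(1) by simp
      then show ?thesis using subgroup.rcos_module_imp[OF Ls(1) is_group g(1)] by blast
    qed
    \<comment> \<open>\<open>?K\<close> is the normalizer of \<open>A\<close>; \<open>inv g L g\<close> normalizes \<open>A = NA \<inter> inv g L g\<close> as \<open>NA\<close> is normal.\<close>
    let ?K = "{x \<in> carrier G. \<forall>a\<in>A. x \<otimes> a \<otimes> inv x \<in> A}"
    have Ks: "subgroup ?K G"
    proof (rule subgroupI)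
      have "\<one> \<in> ?K" using Ac by auto
      then show "?K \<noteq> {}" by blast
      show "x \<otimes> y \<in> ?K" if xy: "x \<in> ?K" "y \<in> ?K" for x y
      proof -
        have "x \<otimes> y \<otimes> a \<otimes> inv (x \<otimes> y) = x \<otimes> (y \<otimes> a \<otimes> inv y) \<otimes> inv x" if "a \<in> A" for a
          using that xy Ac by (auto simp: m_assoc inv_mult_group subset_iff)
        then show ?thesis using xy by auto
      qed
      show "inv x \<in> ?K" if x: "x \<in> ?K" for x
      proof -
        have xc: "x \<in> carrier G" using x by simp
        \<comment> \<open>Membership in \<open>?K\<close> only asks that conjugation map
          \<open>A\<close> into \<open>A\<close>; finiteness of \<open>A\<close> upgrades this to
          onto, which handles inverses.\<close>
        have "inj_on (\<lambda>a. x \<otimes> a \<otimes> inv x) A"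
          using xc Ac by (auto intro!: inj_onI simp: subset_iff)
        moreover have "(\<lambda>a. x \<otimes> a \<otimes> inv x) ` A \<subseteq> A" using x by auto
        ultimately have surj: "(\<lambda>a. x \<otimes> a \<otimes> inv x) ` A = A"
          using finA(1) endo_inj_surj by blast
        have "inv x \<otimes> a \<otimes> x \<in> A" if "a \<in> A" for a
        proof -
          obtain b where b: "b \<in> A" "a = x \<otimes> b \<otimes> inv x" using surj \<open>a \<in> A\<close> by blast
          then have "inv x \<otimes> a \<otimes> x = b" using xc Ac by (simp add: m_assoc subset_iff)
          then show ?thesis using b by simp
        qed
        then show ?thesis using xc by simp
      qed
    qed auto
    have MK: "M \<subseteq> ?K" using normA MLc by blast
    have "?K \<noteq> carrier G"
    proof
      assume "?K = carrier G"
      then have "A \<lhd> G" using As by (intro normal_invI) auto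
      then show False using coreM AM A(2) by blast
    qed
    then have KM: "?K = M" using M Ks MK unfolding maximal_subgroup_def by blast
    have "inv g \<otimes> l \<otimes> g \<in> ?K" if l: "l \<in> L" for l
    proof -
      have lc: "l \<in> carrier G" using l MLc by blast
      have "(inv g \<otimes> l \<otimes> g) \<otimes> a \<otimes> inv (inv g \<otimes> l \<otimes> g) \<in> A" if a: "a \<in> A" for a
      proof -
        have ac: "a \<in> carrier G" using a Ac by blast
        define x where "x = inv g \<otimes> l \<otimes> g"
        have xc: "x \<in> carrier G" using lc g by (simp add: x_def)
        obtain n m where nm: "n \<in> N" "m \<in> M" "x = n \<otimes> m" using NM[OF xc] by blast
        have nmc: "n \<in> carrier G" "m \<in> carrier G" using nm N.subset MLc by auto
        define b where "b = m \<otimes> a \<otimes> inv m"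
        have bA: "b \<in> A" using normA nm a by (simp add: b_def)
        then have bc: "b \<in> carrier G" using Ac by blast
        \<comment> \<open>\<open>k\<close> is the commutator of \<open>n\<close> and
          \<open>b\<close>, so it lies in \<open>N\<close>, and \<open>x\<close> conjugates
          \<open>a\<close> to \<open>k \<otimes> b\<close>. Conjugation by \<open>g\<close> sends
          both \<open>k \<otimes> b\<close> and \<open>b\<close> into \<open>L\<close>, hence
          \<open>k\<close> into \<open>N \<inter> L = {\<one>}\<close>.\<close>
        define k where "k = n \<otimes> (b \<otimes> inv n \<otimes> inv b)"
        have "k \<in> N" unfolding k_def
          using nm(1) bc by (intro N.m_closed N.inv_op_closed2) auto
        have eq: "x \<otimes> a \<otimes> inv x = k \<otimes> b"
          using nmc ac by (simp add: nm(3) b_def k_def m_assoc inv_mult_group)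
        have "g \<otimes> (x \<otimes> a \<otimes> inv x) \<otimes> inv g = l \<otimes> (g \<otimes> a \<otimes> inv g) \<otimes> inv l"
          using lc ac g(1) by (simp add: x_def m_assoc inv_mult_group)
        also have "\<dots> \<in> L"
          using conjA[OF a] l Ls(1) by (simp add: subgroup.m_closed subgroup.m_inv_closed)
        finally have "g \<otimes> (k \<otimes> b) \<otimes> inv g \<in> L" by (simp add: eq)
        moreover have kc: "k \<in> carrier G" using \<open>k \<in> N\<close> N.subset by blast
        have "g \<otimes> (k \<otimes> b) \<otimes> inv g = (g \<otimes> k \<otimes> inv g) \<otimes> (g \<otimes> b \<otimes> inv g)"
          using g(1) bc kc by (simp add: m_assoc)
        moreover have "g \<otimes> k \<otimes> inv g = (g \<otimes> (k \<otimes> b) \<otimes> inv g) \<otimes> inv (g \<otimes> b \<otimes> inv g)"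
          using g(1) bc kc by (simp add: m_assoc inv_mult_group)
        ultimately have "g \<otimes> k \<otimes> inv g \<in> L"
          using conjA[OF bA] Ls(1) by (metis subgroup.m_closed subgroup.m_inv_closed)
        moreover have "g \<otimes> k \<otimes> inv g \<in> N" using N.inv_op_closed2[OF g(1) \<open>k \<in> N\<close>] .
        ultimately have "g \<otimes> k \<otimes> inv g = \<one>" using NLi by blast
        then have "g \<otimes> k = \<one> \<otimes> g" using g(1) kc by (metis inv_solve_right m_closed one_closed)
        then have "k = \<one>" using g(1) kc by simp
        then show ?thesis using eq bA bc by (simp flip: x_def)
      qed
      then show ?thesis using lc g(1) by simp
    qed
    then have gL: "inv g \<otimes> l \<otimes> g \<in> M" if "l \<in> L" for l using KM that by blast
    let ?f = "\<lambda>x. inv g \<otimes> x \<otimes> inv (inv g)"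
    have sub: "?f ` L \<subseteq> M" using gL g(1) by auto
    \<comment> \<open>This is \<open>M\<close> conjugated by \<open>g\<close>: a proper subgroup
      containing \<open>L\<close>, hence equal to \<open>L\<close> by maximality.\<close>
    let ?J = "{x \<in> carrier G. inv g \<otimes> x \<otimes> g \<in> M}"
    have "subgroup ?J G"
    proof (rule subgroupI)
      have "\<one> \<in> ?J" using g(1) Ms(1) by (simp add: subgroup.one_closed)
      then show "?J \<noteq> {}" by blast
      show "inv x \<in> ?J" if "x \<in> ?J" for x
      proof -
        have "inv g \<otimes> inv x \<otimes> g = inv (inv g \<otimes> x \<otimes> g)"
          using that g(1) by (simp add: m_assoc inv_mult_group)
        then show ?thesis using that Ms(1) by (simp add: subgroup.m_inv_closed)
      qed
      show "x \<otimes> y \<in> ?J" if "x \<in> ?J" "y \<in> ?J" for x y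
      proof -
        have "inv g \<otimes> (x \<otimes> y) \<otimes> g = (inv g \<otimes> x \<otimes> g) \<otimes> (inv g \<otimes> y \<otimes> g)"
          using that g(1) by (simp add: m_assoc)
        then show ?thesis using that Ms(1) by (simp add: subgroup.m_closed)
      qed
    qed auto
    moreover have "?J \<noteq> carrier G"
    proof
      assume J: "?J = carrier G"
      have "x \<in> M" if x: "x \<in> carrier G" for x
      proof -
        have "g \<otimes> x \<otimes> inv g \<in> ?J" using J x g(1) by simp
        then show ?thesis using x g(1) by (simp add: m_assoc)
      qed
      then show False using Ms MLc by blast
    qed
    moreover have "L \<subseteq> ?J" using gL MLc by blast
    ultimately have J: "?J = L" using L unfolding maximal_subgroup_def by blast
    have "M \<subseteq> ?f ` L"
    proof
      fix m assume m: "m \<in> M"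
      then have mc: "m \<in> carrier G" using MLc by blast
      have "g \<otimes> m \<otimes> inv g \<in> ?J" using m mc g(1) by (simp add: m_assoc)
      moreover have "m = ?f (g \<otimes> m \<otimes> inv g)" using mc g(1) by (simp add: m_assoc)
      ultimately show "m \<in> ?f ` L" using J by blast
    qed
    then have "M = ?f ` L" using sub by blast
    then show ?thesis using g(1) by blast
  qed
qed

end

section \<open>Ore's theorem by passage to a quotient\<close>

lemma (in group_hom) subgroup_preimage:
  assumes "subgroup K H"
  shows "subgroup {x \<in> carrier G. h x \<in> K} G"
proof (rule G.subgroupI)
  have "\<one> \<in> {x \<in> carrier G. h x \<in> K}" using assms by (simp add: subgroup.one_closed)
  then show "{x \<in> carrier G. h x \<in> K} \<noteq> {}" by blast
qed (use assms in \<open>auto simp: subgroup.m_closed subgroup.m_inv_closed\<close>)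

context group begin

text \<open>Ore: pass to the quotient by the largest normal subgroup contained in both \<open>M\<close> and \<open>L\<close>.\<close>

theorem maximal_conj_or_factor:
  assumes fin: "finite (carrier G)" and sol: "solvable G"
    and M: "maximal_subgroup M G" and L: "maximal_subgroup L G"
  shows "(\<exists>g\<in>carrier G. M = (\<lambda>x. g \<otimes> x \<otimes> inv g) ` L) \<or> M <#> L = carrier G"
proof -
  have Ms: "subgroup M G" "M \<subseteq> carrier G" and Ls: "subgroup L G" "L \<subseteq> carrier G"
    using M L subgroup.subset by (auto simp: maximal_subgroup_def)
  let ?P = "\<lambda>C. C \<lhd> G \<and> C \<subseteq> M \<and> C \<subseteq> L"
  have P1: "?P {\<one>}" using one_is_normal Ms Ls by (simp add: subgroup.one_closed)
  have P2: "\<forall>C. ?P C \<longrightarrow> card C < Suc (card (carrier G))"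
    using Ms(2) fin by (meson card_mono le_imp_less_Suc subset_trans)
  \<comment> \<open>Maximal cardinality is a sufficient notion of largest here: it is only compared
    with normal subgroups that contain \<open>C\<close>.\<close>
  obtain C where C: "?P C" and max: "\<And>D. ?P D \<Longrightarrow> card D \<le> card C"
    using ex_has_greatest_nat[OF P1 P2] by (elim exE conjE) simp
  interpret C: normal C G using C by blast
  let ?Q = "G Mod C"
  define h where "h = (\<lambda>x. C #> x)"
  interpret Q: group ?Q by (rule C.factorgroup_is_group)
  have hh: "group_hom G ?Q h"
    using C.r_coset_hom_Mod by (simp add: group_hom_def group_hom_axioms_def is_group Q.is_group h_def)
  interpret h: group_hom G ?Q h by fact
  have surj: "h ` carrier G = carrier ?Q" by (auto simp: h_def carrier_FactGroup)
  have eqD: "\<exists>c\<in>C. x = c \<otimes> y" if "h x = h y" "x \<in> carrier G" for x y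
    using rcos_self[OF that(2) C.is_subgroup] that(1) by (auto simp: h_def r_coset_def)
  have hC: "h c = \<one>\<^bsub>?Q\<^esub>" if "c \<in> C" for c
    using that C.rcos_const by (simp add: h_def)
  \<comment> \<open>A subgroup containing the kernel \<open>C\<close> is the full preimage of its
    image, so membership can be tested in the quotient.\<close>
  have mem: "x \<in> K" if K: "subgroup K G" "C \<subseteq> K" and x: "x \<in> carrier G" "h x \<in> h ` K" for x K
  proof -
    obtain k where k: "k \<in> K" "h x = h k" using x(2) by blast
    then obtain c where "c \<in> C" "x = c \<otimes> k" using eqD x(1) by blast
    then show ?thesis using k K(2) subgroup.m_closed[OF K(1)] by blast
  qed
  have maxi: "maximal_subgroup (h ` K) ?Q" if K: "maximal_subgroup K G" and CK: "C \<subseteq> K" for K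
    unfolding maximal_subgroup_def
  proof (intro conjI allI impI)
    have Ks: "subgroup K G" "K \<noteq> carrier G" "K \<subseteq> carrier G"
      using K subgroup.subset by (auto simp: maximal_subgroup_def)
    show "subgroup (h ` K) ?Q" using h.subgroup_img_is_subgroup[OF Ks(1)] .
    show "h ` K \<noteq> carrier ?Q"
    proof
      assume "h ` K = carrier ?Q"
      then have "x \<in> K" if "x \<in> carrier G" for x
        using mem[OF Ks(1) CK that] h.hom_closed[OF that] by simp
      then show False using Ks by blast
    qed
    fix D assume D: "subgroup D ?Q \<and> D \<noteq> carrier ?Q \<and> h ` K \<subseteq> D"
    let ?D = "{x \<in> carrier G. h x \<in> D}"
    have Ds: "subgroup D ?Q" using D by simp
    have "d \<in> h ` ?D" if d: "d \<in> D" for d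
    proof -
      have "d \<in> h ` carrier G" using d subgroup.subset[OF Ds] surj by auto
      then show ?thesis using d by blast
    qed
    then have hD: "h ` ?D = D" by blast
    have "subgroup ?D G" using h.subgroup_preimage[OF Ds] .
    moreover have "?D \<noteq> carrier G" using hD surj D by auto
    moreover have "K \<subseteq> ?D" using D Ks by auto
    ultimately have "?D = K" using K by (simp add: maximal_subgroup_def)
    then show "D = h ` K" using hD by simp
  qed
  have core: "D = {\<one>\<^bsub>?Q\<^esub>}" if D: "D \<lhd> ?Q" "D \<subseteq> h ` M" "D \<subseteq> h ` L" for D
  proof -
    \<comment> \<open>The preimage of \<open>D\<close> is normal, lies in \<open>M\<close> and
      \<open>L\<close>, and contains \<open>C\<close>; the choice of \<open>C\<close> forces
      equality.\<close>
    let ?D = "{x \<in> carrier G. h x \<in> D}"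
    have Ds: "subgroup D ?Q" using D normal_imp_subgroup by blast
    have "?D \<lhd> G"
    proof (rule normal_invI[OF h.subgroup_preimage[OF Ds]])
      show "x \<otimes> y \<otimes> inv x \<in> ?D" if "x \<in> carrier G" "y \<in> ?D" for x y
        using that Q.normal_invE(2)[OF D(1), of "h x" "h y"] by simp
    qed
    moreover have "?D \<subseteq> M" "?D \<subseteq> L" using mem[OF Ms(1)] mem[OF Ls(1)] C D(2,3) by auto
    ultimately have "card ?D \<le> card C" using max by blast
    moreover have "C \<subseteq> ?D" using hC subgroup.one_closed[OF Ds] by auto
    moreover have "finite ?D" using fin by simp
    ultimately have DC: "?D = C" using card_seteq by blast
    have "d = \<one>\<^bsub>?Q\<^esub>" if d: "d \<in> D" for d
    proof -
      have "d \<in> h ` carrier G" using d subgroup.subset[OF Ds] surj by auto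
      then obtain x where "x \<in> carrier G" "d = h x" by blast
      then show ?thesis using DC d hC by blast
    qed
    then show ?thesis using subgroup.one_closed[OF Ds] by blast
  qed
  have "finite (carrier ?Q)" using fin surj by (metis finite_imageI)
  moreover have "solvable ?Q" using h.surj_hom_imp_solvable[OF surj sol] .
  ultimately consider (conj) k where "k \<in> carrier ?Q"
      "h ` M = (\<lambda>x. k \<otimes>\<^bsub>?Q\<^esub> x \<otimes>\<^bsub>?Q\<^esub> inv\<^bsub>?Q\<^esub> k) ` (h ` L)"
    | (prod) "h ` M <#>\<^bsub>?Q\<^esub> h ` L = carrier ?Q"
    using Q.maximal_conj_or_factor_if_core_trivial[OF _ _ maxi[OF M] maxi[OF L]] core C by blast
  then show ?thesis
  proof cases
    case conj
    obtain g where g: "g \<in> carrier G" "k = h g" using conj(1) surj by blast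
    have hML: "h ` M = (\<lambda>x. h g \<otimes>\<^bsub>?Q\<^esub> x \<otimes>\<^bsub>?Q\<^esub> inv\<^bsub>?Q\<^esub> h g) ` (h ` L)"
      using conj(2) unfolding g(2) .
    have hg: "h (g \<otimes> l \<otimes> inv g) = h g \<otimes>\<^bsub>?Q\<^esub> h l \<otimes>\<^bsub>?Q\<^esub> inv\<^bsub>?Q\<^esub> h g" if "l \<in> L" for l
      using that Ls g by (simp add: subset_iff)
    have "M = (\<lambda>x. g \<otimes> x \<otimes> inv g) ` L"
    proof
      show "(\<lambda>x. g \<otimes> x \<otimes> inv g) ` L \<subseteq> M"
      proof clarify
        fix l assume l: "l \<in> L"
        then have "h (g \<otimes> l \<otimes> inv g) \<in> h ` M" using hML hg by auto
        then show "g \<otimes> l \<otimes> inv g \<in> M" using mem[OF Ms(1)] C l Ls g(1) by auto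
      qed
      show "M \<subseteq> (\<lambda>x. g \<otimes> x \<otimes> inv g) ` L"
      proof
        fix m assume m: "m \<in> M"
        then have "h m \<in> h ` M" by blast
        then obtain l where l: "l \<in> L" "h m = h (g \<otimes> l \<otimes> inv g)"
          unfolding hML using hg by auto
        obtain c where c: "c \<in> C" "m = c \<otimes> (g \<otimes> l \<otimes> inv g)" using eqD l m Ms by blast
        \<comment> \<open>Equality in the quotient determines \<open>m\<close> only up to a factor
          \<open>c\<close> in \<open>C\<close>. Its conjugate stays in \<open>C\<close>, hence in
          \<open>L\<close>, and is absorbed there.\<close>
        have "inv g \<otimes> c \<otimes> g \<in> L" using C.inv_op_closed1[OF g(1) c(1)] C by auto
        then have "inv g \<otimes> c \<otimes> g \<otimes> l \<in> L" using l Ls subgroup.m_closed by metis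
        moreover have "m = g \<otimes> (inv g \<otimes> c \<otimes> g \<otimes> l) \<otimes> inv g"
          using c g(1) l Ls C.subset by (simp add: m_assoc subset_iff)
        ultimately show "m \<in> (\<lambda>x. g \<otimes> x \<otimes> inv g) ` L" by blast
      qed
    qed
    then show ?thesis using g(1) by blast
  next
    case prod
    have "x \<in> M <#> L" if x: "x \<in> carrier G" for x
    proof -
      have "h x \<in> h ` M <#>\<^bsub>?Q\<^esub> h ` L" using prod x h.hom_closed by simp
      then obtain m l where ml: "m \<in> M" "l \<in> L" "h x = h m \<otimes>\<^bsub>?Q\<^esub> h l"
        unfolding set_mult_def[of ?Q] by blast
      then have mlc: "m \<in> carrier G" "l \<in> carrier G" using Ms Ls by auto
      then have "h x = h (m \<otimes> l)" using ml h.hom_mult by simp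
      then obtain c where c: "c \<in> C" "x = c \<otimes> (m \<otimes> l)" using eqD x by blast
      then have "x = (c \<otimes> m) \<otimes> l" using mlc C.subset by (simp add: m_assoc subset_iff)
      moreover have "c \<otimes> m \<in> M" using c ml C Ms by (meson subgroup.m_closed subsetD)
      ultimately show ?thesis using ml unfolding set_mult_def by blast
    qed
    then show ?thesis using setmult_subset_G[OF Ms(2) Ls(2)] by blast
  qed
qed


subsection \<open>Conjugates and double cosets\<close>

definition conjugate :: "'a set \<Rightarrow> 'a set \<Rightarrow> bool" where
  "conjugate M L \<longleftrightarrow> (\<exists>g\<in>carrier G. M = (\<lambda>x. g \<otimes> x \<otimes> inv g) ` L)"

lemma conjugate_refl: "L \<subseteq> carrier G \<Longrightarrow> conjugate L L"
  unfolding conjugate_def by (intro bexI[of _ \<one>]) (auto simp: subset_iff image_iff)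

lemma conjugate_sym:
  assumes "L \<subseteq> carrier G" "conjugate M L"
  shows "conjugate L M"
proof -
  obtain g where g: "g \<in> carrier G" "M = (\<lambda>x. g \<otimes> x \<otimes> inv g) ` L"
    using assms(2) by (auto simp: conjugate_def)
  have "(\<lambda>x. inv g \<otimes> (g \<otimes> x \<otimes> inv g) \<otimes> inv (inv g)) ` L = (\<lambda>x. x) ` L"
    using g(1) assms(1) by (intro image_cong) (auto simp: m_assoc subset_iff)
  then have "L = (\<lambda>x. inv g \<otimes> x \<otimes> inv (inv g)) ` M" by (simp add: g(2) image_image)
  then show ?thesis using g(1) unfolding conjugate_def by blast
qed

lemma conjugate_trans:
  assumes "L \<subseteq> carrier G" "conjugate K M" "conjugate M L"
  shows "conjugate K L"
proof -
  obtain g where g: "g \<in> carrier G" "M = (\<lambda>x. g \<otimes> x \<otimes> inv g) ` L"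
    using assms(3) by (auto simp: conjugate_def)
  obtain k where k: "k \<in> carrier G" "K = (\<lambda>x. k \<otimes> x \<otimes> inv k) ` M"
    using assms(2) by (auto simp: conjugate_def)
  have "K = (\<lambda>x. (k \<otimes> g) \<otimes> x \<otimes> inv (k \<otimes> g)) ` L"
    unfolding k(2) g(2) image_image using g(1) k(1) assms(1)
    by (intro image_cong) (auto simp: m_assoc inv_mult_group subset_iff)
  then show ?thesis using g(1) k(1) unfolding conjugate_def by blast
qed

text \<open>Under the uniform distribution on the group, \<open>S\<close> and \<open>T\<close> are
  independent events. This supplies orthogonality modulo constants for indicator functions.\<close>

lemma card_inter_eq_if_right_invariant:
  assumes fin: "finite (carrier G)" and sub: "S \<subseteq> carrier G" "T \<subseteq> carrier G"
    and A: "subgroup A G" and B: "subgroup B G" and AB: "A <#> B = carrier G"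
    and S: "\<And>x a. x \<in> S \<Longrightarrow> a \<in> A \<Longrightarrow> x \<otimes> a \<in> S"
    and T: "\<And>x b. x \<in> T \<Longrightarrow> b \<in> B \<Longrightarrow> x \<otimes> b \<in> T"
  shows "card (carrier G) * card (S \<inter> T) = card S * card T"
proof -
  have finST: "finite S" "finite T" using fin sub finite_subset by auto
  \<comment> \<open>Writing \<open>z = ab\<close>, invariance of \<open>S\<close> and \<open>T\<close> shows that \<open>|Sz \<inter> T|\<close> does not depend on \<open>z\<close>; average over \<open>z\<close>.\<close>
  have translate: "card {x \<in> S. x \<otimes> z \<in> T} = card (S \<inter> T)" if z: "z \<in> carrier G" for z
  proof -
    have "z \<in> A <#> B" using z AB by simp
    then obtain a b where ab: "a \<in> A" "b \<in> B" "z = a \<otimes> b" by (auto simp: set_mult_def)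
    have c: "a \<in> carrier G" "b \<in> carrier G"
      using ab subgroup.subset[OF A] subgroup.subset[OF B] by auto
    have iT: "x \<otimes> z \<in> T \<longleftrightarrow> x \<otimes> a \<in> T" if "x \<in> carrier G" for x
    proof
      show "x \<otimes> z \<in> T" if "x \<otimes> a \<in> T"
        using T[OF that ab(2)] \<open>x \<in> carrier G\<close> c by (simp add: ab(3) m_assoc)
      show "x \<otimes> a \<in> T" if "x \<otimes> z \<in> T"
        using T[OF that subgroup.m_inv_closed[OF B ab(2)]] \<open>x \<in> carrier G\<close> c
        by (simp add: ab(3) m_assoc)
    qed
    have "bij_betw (\<lambda>x. x \<otimes> a) {x \<in> S. x \<otimes> z \<in> T} (S \<inter> T)"
    proof (rule bij_betwI[where g = "\<lambda>x. x \<otimes> inv a"])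
      show "(\<lambda>x. x \<otimes> a) \<in> {x \<in> S. x \<otimes> z \<in> T} \<rightarrow> S \<inter> T"
        using S ab(1) iT sub by auto
      show "(\<lambda>x. x \<otimes> inv a) \<in> S \<inter> T \<rightarrow> {x \<in> S. x \<otimes> z \<in> T}"
      proof
        fix x assume x: "x \<in> S \<inter> T"
        then have xc: "x \<in> carrier G" using sub by blast
        have "x \<otimes> inv a \<in> S" using S x subgroup.m_inv_closed[OF A ab(1)] by blast
        moreover have "x \<otimes> inv a \<otimes> z \<in> T" using iT[of "x \<otimes> inv a"] x xc c by (simp add: m_assoc)
        ultimately show "x \<otimes> inv a \<in> {x \<in> S. x \<otimes> z \<in> T}" by blast
      qed
    qed (use sub c in \<open>auto simp: m_assoc subset_iff\<close>)
    then show ?thesis by (rule bij_betw_same_card)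
  qed
  have fibre: "card {z \<in> carrier G. x \<otimes> z \<in> T} = card T" if x: "x \<in> S" for x
  proof -
    have xc: "x \<in> carrier G" using x sub by blast
    have "bij_betw (\<lambda>z. x \<otimes> z) {z \<in> carrier G. x \<otimes> z \<in> T} T"
      by (rule bij_betwI[where g = "\<lambda>z. inv x \<otimes> z"]) (use xc sub in \<open>auto simp: subset_iff\<close>)
    then show ?thesis by (rule bij_betw_same_card)
  qed
  \<comment> \<open>Double counting of the pairs \<open>x \<in> S\<close>, \<open>z\<close> with
    \<open>x \<otimes> z \<in> T\<close>, first by \<open>z\<close> and then by
    \<open>x\<close>.\<close>
  have "card (carrier G) * card (S \<inter> T) = (\<Sum>z\<in>carrier G. card {x \<in> S. x \<otimes> z \<in> T})"
    using translate by simp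
  also have "\<dots> = (\<Sum>z\<in>carrier G. \<Sum>x\<in>S. of_bool (x \<otimes> z \<in> T))"
    using finST by (simp add: sum_of_bool_eq Int_def)
  also have "\<dots> = (\<Sum>x\<in>S. \<Sum>z\<in>carrier G. of_bool (x \<otimes> z \<in> T))" by (rule sum.swap)
  also have "\<dots> = (\<Sum>x\<in>S. card {z \<in> carrier G. x \<otimes> z \<in> T})"
    using fin by (simp add: sum_of_bool_eq Int_def)
  also have "\<dots> = card S * card T" using fibre by simp
  finally show ?thesis .
qed

section \<open>Factorizations by conjugate subgroups\<close>

lemma subgroup_conj:
  assumes "subgroup M G" "g \<in> carrier G"
  shows "subgroup ((\<lambda>x. g \<otimes> x \<otimes> inv g) ` M) G"
proof -
  have Mc: "M \<subseteq> carrier G" using assms(1) subgroup.subset by blast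
  have "group_hom G G (\<lambda>x. g \<otimes> x \<otimes> inv g)"
    unfolding group_hom_def group_hom_axioms_def
    using assms(2) is_group by (auto simp: hom_def m_assoc)
  then show ?thesis using assms(1) by (rule group_hom.subgroup_img_is_subgroup)
qed

text \<open>Factor both \<open>inv g \<otimes> k\<close> and
  \<open>inv g \<otimes> x \<otimes> k\<close> through \<open>M\<close> and \<open>L\<close>; the
  quotients of the \<open>M\<close>-parts and of the \<open>L\<close>-parts give the decomposition
  of \<open>x\<close>. Independent conjugators are needed because each invariant set brings its
  own.\<close>

lemma conj_factor:
  assumes M: "subgroup M G" and L: "subgroup L G" and prod: "M <#> L = carrier G"
    and g: "g \<in> carrier G" and k: "k \<in> carrier G"
  shows "((\<lambda>x. g \<otimes> x \<otimes> inv g) ` M) <#> ((\<lambda>x. k \<otimes> x \<otimes> inv k) ` L) = carrier G"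
proof
  have Mc: "M \<subseteq> carrier G" and Lc: "L \<subseteq> carrier G" using M L subgroup.subset by auto
  show "((\<lambda>x. g \<otimes> x \<otimes> inv g) ` M) <#> ((\<lambda>x. k \<otimes> x \<otimes> inv k) ` L) \<subseteq> carrier G"
    using subgroup_conj M L g k by (intro setmult_subset_G subgroup.subset)
  have fac: "\<exists>m\<in>M. \<exists>l\<in>L. x = m \<otimes> l" if "x \<in> carrier G" for x
  proof -
    have "x \<in> M <#> L" using that prod by simp
    then show ?thesis by (auto simp: set_mult_def)
  qed
  show "carrier G \<subseteq> ((\<lambda>x. g \<otimes> x \<otimes> inv g) ` M) <#> ((\<lambda>x. k \<otimes> x \<otimes> inv k) ` L)"
  proof
    fix x assume x: "x \<in> carrier G"
    obtain m0 l0 where 0: "m0 \<in> M" "l0 \<in> L" "inv g \<otimes> k = m0 \<otimes> l0"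
      using fac[of "inv g \<otimes> k"] g k by auto
    obtain m1 l1 where 1: "m1 \<in> M" "l1 \<in> L" "inv g \<otimes> x \<otimes> k = m1 \<otimes> l1"
      using fac[of "inv g \<otimes> x \<otimes> k"] g k x by auto
    have c: "m0 \<in> carrier G" "l0 \<in> carrier G" "m1 \<in> carrier G" "l1 \<in> carrier G"
      using 0 1 Mc Lc by auto
    define m where "m = m1 \<otimes> inv m0"
    define l where "l = inv l0 \<otimes> l1"
    have ml: "m \<in> M" "l \<in> L"
      using 0 1 by (auto simp: m_def l_def subgroup.m_closed[OF M] subgroup.m_closed[OF L]
          subgroup.m_inv_closed[OF M] subgroup.m_inv_closed[OF L])
    then have mlc: "m \<in> carrier G" "l \<in> carrier G" using Mc Lc by auto
    have "(g \<otimes> m \<otimes> inv g) \<otimes> (k \<otimes> l \<otimes> inv k) = g \<otimes> (m \<otimes> (inv g \<otimes> k) \<otimes> l) \<otimes> inv k"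
      using mlc g k by (simp add: m_assoc)
    also have "m \<otimes> (inv g \<otimes> k) \<otimes> l = inv g \<otimes> x \<otimes> k"
      using c unfolding 0(3) 1(3) by (simp add: m_def l_def m_assoc)
    also have "g \<otimes> (inv g \<otimes> x \<otimes> k) \<otimes> inv k = x" using x g k by (simp add: m_assoc)
    finally have "x = (g \<otimes> m \<otimes> inv g) \<otimes> (k \<otimes> l \<otimes> inv k)" by simp
    then show "x \<in> ((\<lambda>x. g \<otimes> x \<otimes> inv g) ` M) <#> ((\<lambda>x. k \<otimes> x \<otimes> inv k) ` L)"
      using ml unfolding set_mult_def by blast
  qed
qed

section \<open>Double cosets and independent families of invariant sets\<close>

lemma double_coset_iff:
  "x \<in> double_coset G H g K \<longleftrightarrow> (\<exists>h\<in>H. \<exists>k\<in>K. x = h \<otimes> g \<otimes> k)"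
  by (auto simp: double_coset_def r_coset_def set_mult_def)

lemma double_coset_self:
  assumes "subgroup H G" "subgroup K G" "g \<in> carrier G"
  shows "g \<in> double_coset G H g K"
  unfolding double_coset_iff using assms
  by (intro bexI[of _ \<one>]) (auto simp: subgroup.one_closed)

lemma double_coset_subset:
  assumes "subgroup H G" "subgroup K G" "g \<in> carrier G"
  shows "double_coset G H g K \<subseteq> carrier G"
proof -
  have "H \<subseteq> carrier G" "K \<subseteq> carrier G" using assms subgroup.subset by auto
  then show ?thesis using assms(3) by (auto simp: double_coset_iff subset_iff)
qed

lemma double_coset_eq:
  assumes H: "subgroup H G" and K: "subgroup K G" and g: "g \<in> carrier G"
    and x: "x \<in> double_coset G H g K"
  shows "double_coset G H x K = double_coset G H g K"
proof -
  have Hc: "H \<subseteq> carrier G" and Kc: "K \<subseteq> carrier G" using H K subgroup.subset by auto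
  obtain h k where hk: "h \<in> H" "k \<in> K" "x = h \<otimes> g \<otimes> k" using x by (auto simp: double_coset_iff)
  then have c: "h \<in> carrier G" "k \<in> carrier G" using Hc Kc by auto
  show ?thesis
  proof (intro equalityI subsetI)
    fix y assume "y \<in> double_coset G H x K"
    then obtain a b where ab: "a \<in> H" "b \<in> K" "y = a \<otimes> x \<otimes> b" by (auto simp: double_coset_iff)
    then have "a \<in> carrier G" "b \<in> carrier G" using Hc Kc by auto
    then have "y = (a \<otimes> h) \<otimes> g \<otimes> (k \<otimes> b)" using c g by (simp add: ab(3) hk(3) m_assoc)
    moreover have "a \<otimes> h \<in> H" "k \<otimes> b \<in> K"
      using ab hk subgroup.m_closed[OF H] subgroup.m_closed[OF K] by auto
    ultimately show "y \<in> double_coset G H g K" by (auto simp: double_coset_iff)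
  next
    fix y assume "y \<in> double_coset G H g K"
    then obtain a b where ab: "a \<in> H" "b \<in> K" "y = a \<otimes> g \<otimes> b" by (auto simp: double_coset_iff)
    then have "a \<in> carrier G" "b \<in> carrier G" using Hc Kc by auto
    then have "y = (a \<otimes> inv h) \<otimes> x \<otimes> (inv k \<otimes> b)" using c g by (simp add: ab(3) hk(3) m_assoc)
    moreover have "a \<otimes> inv h \<in> H" "inv k \<otimes> b \<in> K"
      using ab hk subgroup.m_closed[OF H] subgroup.m_closed[OF K]
        subgroup.m_inv_closed[OF H] subgroup.m_inv_closed[OF K] by auto
    ultimately show "y \<in> double_coset G H x K" unfolding double_coset_iff by blast
  qed
qed

lemma double_coset_absorb:
  assumes "subgroup H G" "subgroup K G" "H \<subseteq> K" "g \<in> K"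
  shows "double_coset G H g K = K"
proof
  show "double_coset G H g K \<subseteq> K"
    using assms by (auto simp: double_coset_iff subset_iff intro!: subgroup.m_closed[OF assms(2)])
  show "K \<subseteq> double_coset G H g K"
  proof
    fix k assume k: "k \<in> K"
    have "k = \<one> \<otimes> g \<otimes> (inv g \<otimes> k)" using assms(4) k subgroup.subset[OF assms(2)]
      by (simp add: subset_iff)
    moreover have "inv g \<otimes> k \<in> K"
      using assms(4) k subgroup.m_closed[OF assms(2)] subgroup.m_inv_closed[OF assms(2)] by auto
    ultimately show "k \<in> double_coset G H g K"
      using subgroup.one_closed[OF assms(1)] unfolding double_coset_iff by blast
  qed
qed


text \<open>The last clause is linear independence of the indicator functions. The conjugator
  \<open>g\<close> may vary with \<open>S\<close>, which admits a right coset of \<open>M\<close>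
  beside the double cosets. Disjointness from \<open>M\<close> makes all functions in the span
  vanish at the identity, and on \<open>H\<close> when \<open>H\<close> lies in
  \<open>M\<close>.\<close>

definition independent_family :: "'a set \<Rightarrow> 'a set \<Rightarrow> 'a set set \<Rightarrow> bool" where
  "independent_family H M F \<longleftrightarrow> finite F \<and>
     (\<forall>S\<in>F. S \<subseteq> carrier G \<and> S \<inter> M = {} \<and> (\<forall>x\<in>S. \<forall>h\<in>H. h \<otimes> x \<in> S \<and> x \<otimes> h \<in> S) \<and>
       (\<exists>g\<in>carrier G. \<forall>x\<in>S. \<forall>m\<in>M. x \<otimes> (g \<otimes> m \<otimes> inv g) \<in> S)) \<and>
     (\<forall>c. (\<forall>x\<in>carrier G. (\<Sum>S\<in>F. c S * of_bool (x \<in> S)) = (0::real)) \<longrightarrow> (\<forall>S\<in>F. c S = 0))"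

lemma independent_familyI:
  assumes "finite F"
    and "\<And>S. S \<in> F \<Longrightarrow> S \<subseteq> carrier G" "\<And>S. S \<in> F \<Longrightarrow> S \<inter> M = {}"
    and "\<And>S x h. S \<in> F \<Longrightarrow> x \<in> S \<Longrightarrow> h \<in> H \<Longrightarrow> h \<otimes> x \<in> S \<and> x \<otimes> h \<in> S"
    and "\<And>S. S \<in> F \<Longrightarrow> \<exists>g\<in>carrier G. \<forall>x\<in>S. \<forall>m\<in>M. x \<otimes> (g \<otimes> m \<otimes> inv g) \<in> S"
    and ind: "\<And>c S. (\<And>x. x \<in> carrier G \<Longrightarrow> (\<Sum>S\<in>F. c S * of_bool (x \<in> S)) = (0::real)) \<Longrightarrow>
       S \<in> F \<Longrightarrow> c S = 0"
  shows "independent_family H M F"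
  unfolding independent_family_def
proof (intro conjI ballI allI impI)
  show "c S = 0" if "\<forall>x\<in>carrier G. (\<Sum>S\<in>F. c S * of_bool (x \<in> S)) = (0::real)" "S \<in> F" for c S
    using ind that by blast
qed (use assms(1-5) in auto)

text \<open>The conjugate of \<open>M\<close> by \<open>g\<close> contains \<open>H\<close> exactly
  when \<open>HgM = gM\<close>, so these conjugates inject into the \<open>(H,M)\<close>-double
  cosets. Disjointness from \<open>M\<close> costs the double coset \<open>M\<close> itself; the
  cases at the end make up for this loss of one.\<close>

lemma card_conjugates_le_independent_family:
  assumes fin: "finite (carrier G)"
    and M: "subgroup M G" "M \<noteq> carrier G" and H: "subgroup H G" "H \<subseteq> M"
  shows "\<exists>F. independent_family H M F \<and> card {K. conjugate K M \<and> H \<subseteq> K} \<le> card F"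
proof -
  have Mc: "M \<subseteq> carrier G" and Hc: "H \<subseteq> carrier G" using M H subgroup.subset by auto
  let ?dc = "\<lambda>g. double_coset G H g M"
  note [simp] = subgroup.m_closed[OF M(1)] subgroup.m_inv_closed[OF M(1)]
    subgroup.m_closed[OF H(1)] subgroup.m_inv_closed[OF H(1)]
    subgroup.one_closed[OF M(1)] subgroup.one_closed[OF H(1)]
  define DC where "DC = double_cosets G H M"
  have finDC: "finite DC" using fin by (simp add: DC_def double_cosets_def)
  have dcM: "?dc g = M" if "g \<in> M" for g using double_coset_absorb[OF H(1) M(1) H(2) that] .
  have M_DC: "M \<in> DC" using dcM[of \<one>] unfolding DC_def double_cosets_def by (metis image_eqI one_closed subgroup.one_closed[OF M(1)])
  define F0 where "F0 = DC - {M}"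
  have F0_card: "card F0 = card DC - 1" using M_DC finDC by (simp add: F0_def)
  have dc_self: "g \<in> ?dc g" if "g \<in> carrier G" for g
    using double_coset_self[OF H(1) M(1) that] .
  have dc_eq: "D = ?dc x" if "D \<in> DC" "x \<in> D" for D x
    using that double_coset_eq[OF H(1) M(1)] by (auto simp: DC_def double_cosets_def)
  have dc_DC: "?dc g \<in> DC" if "g \<in> carrier G" for g
    using that by (simp add: DC_def double_cosets_def)
  have F0_sub: "D \<subseteq> carrier G" if "D \<in> F0" for D
    using that double_coset_subset[OF H(1) M(1)] by (auto simp: F0_def DC_def double_cosets_def)
  have F0_disj: "D \<inter> M = {}" if "D \<in> F0" for D
  proof (rule ccontr)
    assume "D \<inter> M \<noteq> {}"
    then obtain x where "x \<in> D" "x \<in> M" by blast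
    then have "D = M" using dc_eq[of D x] dcM[of x] that by (simp add: F0_def)
    then show False using that by (simp add: F0_def)
  qed
  have F0_H: "h \<otimes> x \<in> D \<and> x \<otimes> h \<in> D" if D: "D \<in> F0" "x \<in> D" and h: "h \<in> H" for D x h
  proof -
    have xc: "x \<in> carrier G" using F0_sub D by blast
    have eq: "D = ?dc x" using dc_eq D by (simp add: F0_def)
    have hm: "h \<in> carrier G" "h \<in> M" using h H Hc by auto
    have "h \<otimes> x = h \<otimes> x \<otimes> \<one>" "x \<otimes> h = \<one> \<otimes> x \<otimes> h" using xc hm by simp_all
    then show ?thesis
      unfolding eq double_coset_iff using h hm
      by (metis subgroup.one_closed[OF M(1)] subgroup.one_closed[OF H(1)])
  qed
  have F0_M: "x \<otimes> m \<in> D" if D: "D \<in> F0" "x \<in> D" and m: "m \<in> M" for D x m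
  proof -
    have xc: "x \<in> carrier G" using F0_sub D by blast
    have eq: "D = ?dc x" using dc_eq D by (simp add: F0_def)
    have "x \<otimes> m = \<one> \<otimes> x \<otimes> m" using xc m Mc by auto
    then show ?thesis
      unfolding eq double_coset_iff using m subgroup.one_closed[OF H(1)] by blast
  qed
  have F0_conj: "\<exists>g\<in>carrier G. \<forall>x\<in>D. \<forall>m\<in>M. x \<otimes> (g \<otimes> m \<otimes> inv g) \<in> D" if "D \<in> F0" for D
    using F0_M[OF that] Mc
    by (intro bexI[of _ \<one>]) (auto simp: subset_iff)
  have F0_ind: "c D = 0"
    if z: "\<And>x. x \<in> carrier G \<Longrightarrow> (\<Sum>S\<in>F0. c S * of_bool (x \<in> S)) = (0::real)" and D: "D \<in> F0"
    for c D
  proof -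
    obtain x where x: "x \<in> carrier G" "D = ?dc x"
      using D by (auto simp: F0_def DC_def double_cosets_def)
    \<comment> \<open>Distinct double cosets are disjoint, so evaluation at a point of
      \<open>D\<close> isolates the coefficient of \<open>D\<close>.\<close>
    have "x \<in> S \<longleftrightarrow> S = D" if "S \<in> F0" for S
      using that dc_eq[of S x] dc_self[OF x(1)] x(2) by (auto simp: F0_def)
    then have "(\<Sum>S\<in>F0. c S * of_bool (x \<in> S)) = (\<Sum>S\<in>F0. c S * of_bool (S = D))"
      by (intro sum.cong) auto
    also have "\<dots> = c D" using D finDC by (simp add: F0_def)
    finally show ?thesis using z[OF x(1)] by simp
  qed
  have F0: "independent_family H M F0"
  proof (rule independent_familyI)
    show "finite F0" using finDC by (simp add: F0_def)
  qed (fact F0_sub F0_disj F0_H F0_conj F0_ind)+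
  define P where "P = ?dc ` {g \<in> carrier G. \<forall>h\<in>H. inv g \<otimes> h \<otimes> g \<in> M}"
  have P_DC: "P \<subseteq> DC" using dc_DC by (auto simp: P_def)
  let ?C = "{K. conjugate K M \<and> H \<subseteq> K}"
  have "\<exists>f. inj_on f ?C \<and> f ` ?C \<subseteq> P"
  proof -
    have "\<forall>K\<in>?C. \<exists>g. g \<in> carrier G \<and> K = (\<lambda>x. g \<otimes> x \<otimes> inv g) ` M"
      by (auto simp: conjugate_def)
    then obtain \<gamma> where \<gamma>: "\<And>K. K \<in> ?C \<Longrightarrow> \<gamma> K \<in> carrier G"
      "\<And>K. K \<in> ?C \<Longrightarrow> K = (\<lambda>x. \<gamma> K \<otimes> x \<otimes> inv \<gamma> K) ` M" by metis
    have \<gamma>_H: "inv \<gamma> K \<otimes> h \<otimes> \<gamma> K \<in> M" if K: "K \<in> ?C" and h: "h \<in> H" for K h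
    proof -
      have "h \<in> K" using K h by blast
      then obtain m where m: "m \<in> M" "h = \<gamma> K \<otimes> m \<otimes> inv \<gamma> K" using \<gamma>(2)[OF K] by blast
      then have "inv \<gamma> K \<otimes> h \<otimes> \<gamma> K = m" using \<gamma>(1)[OF K] Mc by (simp add: m_assoc subset_iff)
      then show ?thesis using m by simp
    qed
    have "inj_on (\<lambda>K. ?dc (\<gamma> K)) ?C"
    proof (rule inj_onI)
      fix K L assume K: "K \<in> ?C" and L: "L \<in> ?C" and eq: "?dc (\<gamma> K) = ?dc (\<gamma> L)"
      let ?g = "\<gamma> K" and ?k = "\<gamma> L"
      have c: "?g \<in> carrier G" "?k \<in> carrier G" using \<gamma>(1) K L by auto
      have "?k \<in> ?dc ?g" using dc_self[OF c(2)] eq by simp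
      then obtain h m where hm: "h \<in> H" "m \<in> M" "?k = h \<otimes> ?g \<otimes> m" by (auto simp: double_coset_iff)
      \<comment> \<open>Since \<open>?g\<close> conjugates \<open>M\<close> to \<open>K\<close>,
        which contains \<open>h\<close>, the factor \<open>h\<close> moves past \<open>?g\<close>
        into \<open>M\<close>. Thus \<open>?k\<close> and \<open>?g\<close> lie in the same left
        coset of \<open>M\<close> and conjugate \<open>M\<close> to the same subgroup.\<close>
      define n where "n = (inv ?g \<otimes> h \<otimes> ?g) \<otimes> m"
      have n: "n \<in> M" using \<gamma>_H[OF K hm(1)] hm(2) by (simp add: n_def)
      have nc: "n \<in> carrier G" "h \<in> carrier G" "m \<in> carrier G" using n hm Mc Hc by auto
      have k: "?k = ?g \<otimes> n" using c nc by (simp add: hm(3) n_def m_assoc)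
      have kg: "?k \<otimes> x \<otimes> inv ?k = ?g \<otimes> (n \<otimes> x \<otimes> inv n) \<otimes> inv ?g" if "x \<in> M" for x
        using that Mc c(1) nc by (simp add: k m_assoc inv_mult_group subset_iff)
      have "L = (\<lambda>x. ?k \<otimes> x \<otimes> inv ?k) ` M" by (rule \<gamma>(2)[OF L])
      also have "\<dots> = (\<lambda>x. ?g \<otimes> (n \<otimes> x \<otimes> inv n) \<otimes> inv ?g) ` M"
        by (rule image_cong[OF refl kg])
      also have "\<dots> = (\<lambda>x. ?g \<otimes> x \<otimes> inv ?g) ` ((\<lambda>x. n \<otimes> x \<otimes> inv n) ` M)"
        by (simp only: image_image)
      also have "(\<lambda>x. n \<otimes> x \<otimes> inv n) ` M = M"
      proof
        show "M \<subseteq> (\<lambda>x. n \<otimes> x \<otimes> inv n) ` M"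
        proof
          fix x assume x: "x \<in> M"
          have "x = n \<otimes> (inv n \<otimes> x \<otimes> n) \<otimes> inv n" using x Mc nc by (simp add: m_assoc subset_iff)
          then show "x \<in> (\<lambda>x. n \<otimes> x \<otimes> inv n) ` M"
            by (rule image_eqI) (use x n in auto)
        qed
      qed (use n in auto)
      also have "(\<lambda>x. ?g \<otimes> x \<otimes> inv ?g) ` M = K" by (rule \<gamma>(2)[OF K, symmetric])
      finally show "K = L" by simp
    qed
    moreover have "(\<lambda>K. ?dc (\<gamma> K)) ` ?C \<subseteq> P" using \<gamma>(1) \<gamma>_H unfolding P_def by blast
    ultimately show ?thesis by blast
  qed
  then have card_P: "card ?C \<le> card P"
    using card_inj_on_le finite_subset[OF P_DC finDC] by blast
  \<comment> \<open>In \<open>proper\<close>, a double coset outside \<open>P\<close> pays for the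
    omitted \<open>M\<close>. In \<open>normal\<close>, there is at most one conjugate and
    \<open>F0\<close> is nonempty. In \<open>core\<close>, \<open>H\<close> lies in every conjugate
    of \<open>M\<close>, and one extra set is required.\<close>
  consider (proper) "P \<noteq> DC"
    | (normal) "\<forall>g\<in>carrier G. \<forall>m\<in>M. g \<otimes> m \<otimes> inv g \<in> M"
    | (core) "P = DC" "\<exists>g\<in>carrier G. \<exists>m\<in>M. g \<otimes> m \<otimes> inv g \<notin> M"
    by blast
  then show ?thesis
  proof cases
    case proper
    then have "card P < card DC" using P_DC finDC psubset_card_mono by blast
    then have "card ?C \<le> card F0" using card_P F0_card by simp
    then show ?thesis using F0 by blast
  next
    case normal
    have "K = M" if K: "conjugate K M" for K
    proof -
      have "K \<subseteq> M" using K normal by (auto simp: conjugate_def)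
      moreover have "M \<subseteq> K"
      proof -
        have "conjugate M K" using conjugate_sym[OF Mc K] .
        then obtain g where g: "g \<in> carrier G" "M = (\<lambda>x. g \<otimes> x \<otimes> inv g) ` K"
          by (auto simp: conjugate_def)
        show ?thesis
        proof
          fix m assume m: "m \<in> M"
          then have "g \<otimes> m \<otimes> inv g \<in> M" using normal g(1) by blast
          then obtain k where k: "k \<in> K" "g \<otimes> m \<otimes> inv g = g \<otimes> k \<otimes> inv g" using g(2) by blast
          have "k \<in> carrier G" "m \<in> carrier G" using k \<open>K \<subseteq> M\<close> m Mc by auto
          then have "m = k" using k(2) g(1) by simp
          then show "m \<in> K" using k by simp
        qed
      qed
      ultimately show ?thesis by blast
    qed
    then have "?C \<subseteq> {M}" by blast
    then have "card ?C \<le> 1" by (metis card_mono finite.emptyI finite_insert card_1_singleton_iff One_nat_def)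
    moreover obtain x where x: "x \<in> carrier G" "x \<notin> M" using M(2) Mc by blast
    have "?dc x \<in> F0" using dc_DC[OF x(1)] dc_self[OF x(1)] x(2) by (auto simp: F0_def)
    then have "card F0 \<ge> 1"
      using finDC by (metis F0_def One_nat_def Suc_leI card_gt_0_iff empty_iff finite_Diff)
    ultimately have "card ?C \<le> card F0" by simp
    then show ?thesis using F0 by blast
  next
    case core
    then obtain g m where g: "g \<in> carrier G" "m \<in> M" "g \<otimes> m \<otimes> inv g \<notin> M" by blast
    have mc: "m \<in> carrier G" using g(2) Mc by blast
    have gM: "g \<notin> M" using g by auto
    \<comment> \<open>\<open>E\<close> contains \<open>g\<close> but not
      \<open>g \<otimes> m\<close>, so it is not right invariant under \<open>M\<close>, unlike the
      members of \<open>F0\<close>. It is right invariant under the conjugate of \<open>M\<close> by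
      \<open>inv g\<close>.\<close>
    define E where "E = M #> g"
    have E_iff: "x \<in> E \<longleftrightarrow> x \<otimes> inv g \<in> M" if x: "x \<in> carrier G" for x
    proof
      assume "x \<in> E"
      then obtain n where "n \<in> M" "x = n \<otimes> g" by (auto simp: E_def r_coset_def)
      then show "x \<otimes> inv g \<in> M" using g(1) Mc by (simp add: m_assoc subset_iff)
    next
      assume *: "x \<otimes> inv g \<in> M"
      have "x = (x \<otimes> inv g) \<otimes> g" using x g(1) by (simp add: m_assoc)
      then show "x \<in> E" using * unfolding E_def r_coset_def by blast
    qed
    have Ec: "E \<subseteq> carrier G" using g(1) Mc unfolding E_def by (rule r_coset_subset_G[rotated])
    have gE: "g \<in> E" using E_iff[OF g(1)] g(1) by simp
    have gmE: "g \<otimes> m \<notin> E" using E_iff[of "g \<otimes> m"] g mc by simp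
    \<comment> \<open>\<open>P = DC\<close> yields one suitable representative \<open>y\<close> per
      double coset; writing \<open>x = a \<otimes> y \<otimes> b\<close> carries the property to
      every element.\<close>
    have core_H: "inv x \<otimes> h \<otimes> x \<in> M" if x: "x \<in> carrier G" and h: "h \<in> H" for x h
    proof -
      have "?dc x \<in> P" using core(1) dc_DC x by blast
      then obtain y where y: "y \<in> carrier G" "\<forall>h\<in>H. inv y \<otimes> h \<otimes> y \<in> M" "?dc x = ?dc y"
        unfolding P_def by blast
      then have "x \<in> ?dc y" using dc_self x by blast
      then obtain a b where ab: "a \<in> H" "b \<in> M" "x = a \<otimes> y \<otimes> b" by (auto simp: double_coset_iff)
      then have c: "a \<in> carrier G" "b \<in> carrier G" "h \<in> carrier G" using h Hc Mc by auto
      have "inv x \<otimes> h \<otimes> x = inv b \<otimes> (inv y \<otimes> (inv a \<otimes> h \<otimes> a) \<otimes> y) \<otimes> b"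
        using c y(1) by (simp add: ab(3) m_assoc inv_mult_group)
      moreover have "inv y \<otimes> (inv a \<otimes> h \<otimes> a) \<otimes> y \<in> M" using y(2) ab(1) h by simp
      ultimately show ?thesis using ab(2) by simp
    qed
    have E_H: "h \<otimes> x \<in> E \<and> x \<otimes> h \<in> E" if x: "x \<in> E" and h: "h \<in> H" for x h
    proof -
      have c: "x \<in> carrier G" "h \<in> carrier G" "h \<in> M" using x h Ec Hc H by auto
      have xg: "x \<otimes> inv g \<in> M" using E_iff x c by blast
      have "h \<otimes> x \<otimes> inv g = h \<otimes> (x \<otimes> inv g)" using c g(1) by (simp add: m_assoc)
      then have 1: "h \<otimes> x \<otimes> inv g \<in> M" using xg c by simp
      have "x \<otimes> h \<otimes> inv g = (x \<otimes> inv g) \<otimes> (g \<otimes> h \<otimes> inv g)" using c g(1) by (simp add: m_assoc)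
      moreover have "g \<otimes> h \<otimes> inv g \<in> M" using core_H[of "inv g" h] g(1) h by simp
      ultimately have "x \<otimes> h \<otimes> inv g \<in> M" using xg by simp
      with 1 show ?thesis using E_iff c by simp
    qed
    have E_disj: "E \<inter> M = {}"
    proof (rule ccontr)
      assume "E \<inter> M \<noteq> {}"
      then obtain x where x: "x \<in> E" "x \<in> M" by blast
      then have xc: "x \<in> carrier G" using Mc by blast
      then have "x \<otimes> inv g \<in> M" using E_iff x by blast
      then have "inv (x \<otimes> inv g) \<otimes> x \<in> M" using x by simp
      then show False using gM g(1) xc by (simp add: inv_mult_group m_assoc)
    qed
    have E_conj: "\<exists>k\<in>carrier G. \<forall>x\<in>E. \<forall>m\<in>M. x \<otimes> (k \<otimes> m \<otimes> inv k) \<in> E"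
    proof (intro bexI[of _ "inv g"] ballI)
      fix x n assume x: "x \<in> E" and n: "n \<in> M"
      have c: "x \<in> carrier G" "n \<in> carrier G" using x n Ec Mc by auto
      have "x \<otimes> (inv g \<otimes> n \<otimes> inv (inv g)) \<otimes> inv g = (x \<otimes> inv g) \<otimes> n"
        using c g(1) by (simp add: m_assoc)
      then have "x \<otimes> (inv g \<otimes> n \<otimes> inv (inv g)) \<otimes> inv g \<in> M" using E_iff[OF c(1)] x n by simp
      then show "x \<otimes> (inv g \<otimes> n \<otimes> inv (inv g)) \<in> E" using E_iff c g(1) by simp
    qed (use g in simp)
    have finF0: "finite F0" using finDC by (simp add: F0_def)
    have E_F0: "E \<notin> F0"
      using F0_M[of E g m] gE gmE g(2) by auto
    have ind: "c D = 0"
      if z: "\<And>x. x \<in> carrier G \<Longrightarrow> (\<Sum>S\<in>insert E F0. c S * of_bool (x \<in> S)) = (0::real)"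
        and D: "D \<in> insert E F0" for c D
    proof -
      have split: "c E * of_bool (x \<in> E) + (\<Sum>S\<in>F0. c S * of_bool (x \<in> S)) = 0"
        if "x \<in> carrier G" for x
        using trans[OF sum.insert[OF finF0 E_F0, symmetric] z[OF that]] .
      \<comment> \<open>The members of \<open>F0\<close> do not distinguish \<open>g\<close> from
        \<open>g \<otimes> m\<close>, but \<open>E\<close> does; comparing the relation at these two
        points gives \<open>c E = 0\<close>.\<close>
      have "of_bool (g \<in> S) = (of_bool (g \<otimes> m \<in> S) :: real)" if S: "S \<in> F0" for S
      proof -
        have "g \<otimes> m \<in> S" if "g \<in> S" using F0_M[OF S that g(2)] .
        moreover have "g \<in> S" if "g \<otimes> m \<in> S"
          using F0_M[OF S that, of "inv m"] g mc by (simp add: m_assoc)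
        ultimately show ?thesis by auto
      qed
      then have "(\<Sum>S\<in>F0. c S * of_bool (g \<in> S)) = (\<Sum>S\<in>F0. c S * of_bool (g \<otimes> m \<in> S))"
        by (intro sum.cong) auto
      then have cE: "c E = 0" using split[OF g(1)] split[of "g \<otimes> m"] gE gmE g(1) mc by simp
      then have "(\<Sum>S\<in>F0. c S * of_bool (x \<in> S)) = 0" if "x \<in> carrier G" for x
        using split[OF that] by simp
      then show ?thesis using F0_ind[of c D] D cE by blast
    qed
    have "card DC > 0" using M_DC finDC card_gt_0_iff by blast
    then have "card ?C \<le> card (insert E F0)"
      using card_P core(1) F0_card E_F0 finDC by (simp add: F0_def)
    moreover have "independent_family H M (insert E F0)"
    proof (rule independent_familyI)
      show "finite (insert E F0)" using finF0 by simp
      show "S \<subseteq> carrier G" if "S \<in> insert E F0" for S using that Ec F0_sub by auto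
      show "S \<inter> M = {}" if "S \<in> insert E F0" for S using that E_disj F0_disj by auto
      show "h \<otimes> x \<in> S \<and> x \<otimes> h \<in> S" if "S \<in> insert E F0" "x \<in> S" "h \<in> H" for S x h
        using that E_H F0_H by auto
      show "\<exists>g\<in>carrier G. \<forall>x\<in>S. \<forall>m\<in>M. x \<otimes> (g \<otimes> m \<otimes> inv g) \<in> S" if "S \<in> insert E F0" for S
        using that E_conj F0_conj by auto
      show "c S = 0"
        if "\<And>x. x \<in> carrier G \<Longrightarrow> (\<Sum>S\<in>insert E F0. c S * of_bool (x \<in> S)) = (0::real)"
          "S \<in> insert E F0" for c S
        using ind that by blast
    qed
    ultimately show ?thesis by blast
  qed
qed

end

section \<open>Combination of the conjugacy classes and the final count\<close>

theorem theorem2p9: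
  fixes G :: "('a, 'b) monoid_scheme" and H :: "'a set"
  assumes "group G"
    and "finite (carrier G)"
    and "solvable G"
    and "subgroup H G"
  shows "card {M. maximal_subgroup M G \<and> H \<subseteq> M} < card (double_cosets G H H)"
proof -
  interpret group G by fact
  note fin = assms(2) and H = assms(4)
  have Hc: "H \<subseteq> carrier G" using H subgroup.subset by blast
  define \<M> where "\<M> = {M. maximal_subgroup M G \<and> H \<subseteq> M}"
  have sub: "subgroup M G" "M \<noteq> carrier G" "M \<subseteq> carrier G" "H \<subseteq> M" "maximal_subgroup M G"
    if "M \<in> \<M>" for M
    using that subgroup.subset by (auto simp: \<M>_def maximal_subgroup_def)
  have "\<M> \<subseteq> Pow (carrier G)" using sub by blast
  then have fin\<M>: "finite \<M>" using fin finite_subset by blast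
  \<comment> \<open>The choice predicate depends only on the conjugacy class of \<open>K\<close>, so
    \<open>SOME\<close> picks the same subgroup throughout a class, and \<open>R\<close> holds one
    representative per class.\<close>
  define rep where "rep K = (SOME M. M \<in> \<M> \<and> conjugate K M)" for K
  define R where "R = rep ` \<M>"
  have rep: "rep K \<in> \<M> \<and> conjugate K (rep K)" if "K \<in> \<M>" for K
    unfolding rep_def by (rule someI[of _ K]) (use that conjugate_refl sub in auto)
  have finR: "finite R" and R\<M>: "R \<subseteq> \<M>" using fin\<M> rep by (auto simp: R_def)
  have rep_unique: "M = L" if M: "M \<in> R" and L: "L \<in> R" and MconjL: "conjugate M L" for M L
  proof -
    obtain K K' where K: "K \<in> \<M>" "M = rep K" and K': "K' \<in> \<M>" "L = rep K'"
      using M L by (auto simp: R_def)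
    have c: "K \<subseteq> carrier G" "K' \<subseteq> carrier G" "M \<subseteq> carrier G" "L \<subseteq> carrier G"
      using sub(3) K(1) K'(1) M L R\<M> by auto
    have "conjugate K L" using conjugate_trans[OF c(4) _ MconjL] rep[OF K(1)] K(2) by simp
    moreover have "conjugate L K'"
      using conjugate_sym[OF c(4)] rep[OF K'(1)] K'(2) by simp
    ultimately have KK': "conjugate K K'" by (rule conjugate_trans[OF c(2)])
    have "conjugate K N \<longleftrightarrow> conjugate K' N" if "N \<in> \<M>" for N
      using conjugate_trans[OF sub(3)[OF that]] conjugate_sym[OF c(2) KK'] KK' by metis
    then have "(\<lambda>N. N \<in> \<M> \<and> conjugate K N) = (\<lambda>N. N \<in> \<M> \<and> conjugate K' N)" by blast
    then show ?thesis by (simp add: K(2) K'(2) rep_def)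
  qed
  have "\<forall>M\<in>R. \<exists>F. independent_family H M F \<and> card {K. conjugate K M \<and> H \<subseteq> K} \<le> card F"
    using card_conjugates_le_independent_family[OF fin sub(1) sub(2) H sub(4)] R\<M> by blast
  then obtain F where F: "\<And>M. M \<in> R \<Longrightarrow> independent_family H M (F M)"
    and cardF: "\<And>M. M \<in> R \<Longrightarrow> card {K. conjugate K M \<and> H \<subseteq> K} \<le> card (F M)"
    by metis
  have finF: "finite (F M)" if "M \<in> R" for M
    using F[OF that] by (simp add: independent_family_def)
  have F_sub: "S \<subseteq> carrier G" and F_disj: "S \<inter> M = {}"
    and F_conj: "\<exists>g\<in>carrier G. \<forall>x\<in>S. \<forall>m\<in>M. x \<otimes>\<^bsub>G\<^esub> (g \<otimes>\<^bsub>G\<^esub> m \<otimes>\<^bsub>G\<^esub> inv\<^bsub>G\<^esub> g) \<in> S"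
    if "M \<in> R" "S \<in> F M" for M S
    using F[OF that(1)] that(2) by (simp_all add: independent_family_def)
  have F_H: "h \<otimes>\<^bsub>G\<^esub> x \<in> S \<and> x \<otimes>\<^bsub>G\<^esub> h \<in> S" if "M \<in> R" "S \<in> F M" "x \<in> S" "h \<in> H" for M S x h
    using F[OF that(1)] that(2-) by (simp add: independent_family_def)
  have F_ind: "c S = 0"
    if "M \<in> R" "\<forall>x\<in>carrier G. (\<Sum>S\<in>F M. c S * of_bool (x \<in> S)) = (0::real)" "S \<in> F M" for M c S
  proof -
    have "\<forall>c. (\<forall>x\<in>carrier G. (\<Sum>S\<in>F M. c S * of_bool (x \<in> S)) = (0::real)) \<longrightarrow> (\<forall>S\<in>F M. c S = 0)"
      using F[OF that(1)] unfolding independent_family_def by (elim conjE)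
    from this[THEN spec[of _ c], THEN mp, OF that(2)] show ?thesis using that(3) by blast
  qed
  \<comment> \<open>All sets in the families avoid \<open>H\<close>, so the double coset
    \<open>H\<close> imposes no equation. Leaving it out makes the final inequality strict.\<close>
  define J where "J = double_cosets G H H - {H}"
  have finD: "finite (double_cosets G H H)" using fin by (simp add: double_cosets_def)
  have H_dc: "double_coset G H h H = H" if "h \<in> H" for h
    using double_coset_absorb[OF H H _ that] by simp
  have HD: "H \<in> double_cosets G H H"
    unfolding double_cosets_def using H_dc[of "\<one>\<^bsub>G\<^esub>"] subgroup.one_closed[OF H]
    by (intro image_eqI[of _ _ "\<one>\<^bsub>G\<^esub>"]) auto
  have finSigma: "finite (Sigma R F)" using finR finF by blast
  have orth: "card (carrier G) * card (S \<inter> T) = card S * card T"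
    if M: "M \<in> R" and L: "L \<in> R" and neq: "M \<noteq> L" and S: "S \<in> F M" and T: "T \<in> F L"
    for M L S T
  proof -
    have m: "M \<in> \<M>" "L \<in> \<M>" using M L R\<M> by auto
    have "\<not> conjugate M L" using rep_unique M L neq by blast
    then have prod: "M <#>\<^bsub>G\<^esub> L = carrier G"
      using maximal_conj_or_factor[OF fin assms(3) sub(5)[OF m(1)] sub(5)[OF m(2)]]
      by (simp add: conjugate_def)
    obtain g where g: "g \<in> carrier G" "\<forall>x\<in>S. \<forall>m\<in>M. x \<otimes>\<^bsub>G\<^esub> (g \<otimes>\<^bsub>G\<^esub> m \<otimes>\<^bsub>G\<^esub> inv\<^bsub>G\<^esub> g) \<in> S"
      using F_conj[OF M S] by blast
    obtain k where k: "k \<in> carrier G" "\<forall>x\<in>T. \<forall>m\<in>L. x \<otimes>\<^bsub>G\<^esub> (k \<otimes>\<^bsub>G\<^esub> m \<otimes>\<^bsub>G\<^esub> inv\<^bsub>G\<^esub> k) \<in> T"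
      using F_conj[OF L T] by blast
    show ?thesis
      using card_inter_eq_if_right_invariant[OF fin F_sub[OF M S] F_sub[OF L T]
          subgroup_conj[OF sub(1)[OF m(1)] g(1)] subgroup_conj[OF sub(1)[OF m(2)] k(1)]
          conj_factor[OF sub(1)[OF m(1)] sub(1)[OF m(2)] prod g(1) k(1)]] g(2) k(2)
      by auto
  qed
  have "card (Sigma R F) \<le> card J"
  proof (rule ccontr)
    assume "\<not> card (Sigma R F) \<le> card J"
    then have less: "card J < card (Sigma R F)" by simp
    have finJ: "finite J" using finD by (simp add: J_def)
    \<comment> \<open>One unknown per pair \<open>(M, S)\<close> and one equation per
      \<open>D\<close> in \<open>J\<close>. Each \<open>S\<close> is a union of
      \<open>(H,H)\<close>-double cosets, so the coefficient is the value of its indicator on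
      \<open>D\<close>.\<close>
    obtain c :: "'a set \<times> 'a set \<Rightarrow> real" where c: "\<exists>i\<in>Sigma R F. c i \<noteq> 0"
      "\<forall>D\<in>J. (\<Sum>i\<in>Sigma R F. c i * of_bool (D \<subseteq> snd i)) = 0"
      using underdetermined_system_nontrivial_solution[OF finJ finSigma less,
          of "\<lambda>i D. of_bool (D \<subseteq> snd i)"] by blast
    \<comment> \<open>The contribution of one conjugacy class to the linear relation; the classes
      are separated first, and the sets within a class afterwards.\<close>
    define s where "s M x = (\<Sum>S\<in>F M. c (M, S) * of_bool (x \<in> S))" for M x
    have sum_s: "(\<Sum>M\<in>R. s M x) = (\<Sum>i\<in>Sigma R F. c i * of_bool (x \<in> snd i))" for x
      unfolding s_def using finR finF by (subst sum.Sigma) (auto simp: split_def)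
    have zero: "(\<Sum>M\<in>R. s M x) = 0" if x: "x \<in> carrier G" for x
    proof (cases "x \<in> H")
      case True
      then have "x \<notin> S" if "M \<in> R" "S \<in> F M" for M S
        using that F_disj sub(4) R\<M> by blast
      then show ?thesis by (simp add: s_def)
    next
      case False
      let ?D = "double_coset G H x H"
      have xD: "x \<in> ?D" using double_coset_self[OF H H x] .
      then have "?D \<in> J" using x False by (auto simp: J_def double_cosets_def)
      moreover have iff: "x \<in> S \<longleftrightarrow> ?D \<subseteq> S" if "M \<in> R" "S \<in> F M" for M S
      proof
        show "?D \<subseteq> S" if "x \<in> S"
          using F_H[OF \<open>M \<in> R\<close> \<open>S \<in> F M\<close>] that by (auto simp: double_coset_iff)
      qed (use xD in blast)
      have "(\<Sum>i\<in>Sigma R F. c i * of_bool (x \<in> snd i)) = (\<Sum>i\<in>Sigma R F. c i * of_bool (?D \<subseteq> snd i))"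
        using iff by (intro sum.cong) auto
      ultimately show ?thesis unfolding sum_s using c(2) by simp
    qed
    have tot: "(\<Sum>x\<in>carrier G. s M x) = (\<Sum>S\<in>F M. c (M, S) * card S)" if M: "M \<in> R" for M
    proof -
      have "(\<Sum>x\<in>carrier G. s M x) = (\<Sum>S\<in>F M. \<Sum>x\<in>carrier G. c (M, S) * of_bool (x \<in> S))"
        unfolding s_def by (rule sum.swap)
      also have "\<dots> = (\<Sum>S\<in>F M. c (M, S) * card S)"
        using fin F_sub[OF M]
        by (intro sum.cong refl) (auto simp: sum_of_bool_eq Int_absorb1 simp flip: sum_distrib_left)
      finally show ?thesis .
    qed
    \<comment> \<open>The independence of pairs of sets in \<open>orth\<close> extends bilinearly to
      linear combinations.\<close>
    have prod_tot: "card (carrier G) * (\<Sum>x\<in>carrier G. s M x * s L x) =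
        (\<Sum>x\<in>carrier G. s M x) * (\<Sum>x\<in>carrier G. s L x)"
      if M: "M \<in> R" and L: "L \<in> R" and neq: "M \<noteq> L" for M L
    proof -
      have "(\<Sum>x\<in>carrier G. s M x * s L x) =
          (\<Sum>x\<in>carrier G. \<Sum>S\<in>F M. \<Sum>T\<in>F L. c (M, S) * c (L, T) * of_bool (x \<in> S \<inter> T))"
        unfolding s_def sum_product by (intro sum.cong refl) auto
      also have "\<dots> = (\<Sum>S\<in>F M. \<Sum>x\<in>carrier G. \<Sum>T\<in>F L. c (M, S) * c (L, T) * of_bool (x \<in> S \<inter> T))"
        by (rule sum.swap)
      also have "\<dots> = (\<Sum>S\<in>F M. \<Sum>T\<in>F L. \<Sum>x\<in>carrier G. c (M, S) * c (L, T) * of_bool (x \<in> S \<inter> T))"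
        by (intro sum.cong refl sum.swap)
      also have "\<dots> = (\<Sum>S\<in>F M. \<Sum>T\<in>F L. c (M, S) * c (L, T) * card (S \<inter> T))"
      proof (intro sum.cong refl)
        fix S T assume "S \<in> F M" "T \<in> F L"
        then have "carrier G \<inter> (S \<inter> T) = S \<inter> T" using F_sub[OF M] by blast
        then show "(\<Sum>x\<in>carrier G. c (M, S) * c (L, T) * of_bool (x \<in> S \<inter> T)) =
            c (M, S) * c (L, T) * card (S \<inter> T)"
          using fin by (simp only: sum_distrib_left[symmetric] sum_of_bool_eq Collect_mem_eq)
      qed
      finally have "card (carrier G) * (\<Sum>x\<in>carrier G. s M x * s L x) =
          (\<Sum>S\<in>F M. \<Sum>T\<in>F L. c (M, S) * c (L, T) * real (card (carrier G) * card (S \<inter> T)))"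
        by (simp add: sum_distrib_left mult_ac)
      also have "\<dots> = (\<Sum>S\<in>F M. \<Sum>T\<in>F L. (c (M, S) * card S) * (c (L, T) * card T))"
      proof (intro sum.cong refl)
        fix S T assume "S \<in> F M" "T \<in> F L"
        note eq = orth[OF M L neq this]
        show "c (M, S) * c (L, T) * real (card (carrier G) * card (S \<inter> T)) =
            c (M, S) * card S * (c (L, T) * card T)"
          unfolding eq by simp
      qed
      also have "\<dots> = (\<Sum>x\<in>carrier G. s M x) * (\<Sum>x\<in>carrier G. s L x)"
        unfolding tot[OF M] tot[OF L] by (simp add: sum_product)
      finally show ?thesis .
    qed
    have s0: "s M x = 0" if M: "M \<in> R" and x: "x \<in> carrier G" for M x
    proof (rule orthogonal_modulo_constants_sum_eq_0[OF finR fin prod_tot zero M one_closed _ x])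
      \<comment> \<open>The identity serves as the common zero that rules out nonzero constants,
        because the sets in \<open>F M\<close> avoid \<open>M\<close>.\<close>
      have "\<one>\<^bsub>G\<^esub> \<notin> S" if "S \<in> F M" for S
        using F_disj[OF M that] subgroup.one_closed[OF sub(1)] M R\<M> by blast
      then show "s M \<one>\<^bsub>G\<^esub> = 0" by (simp add: s_def)
    qed auto
    have "c (M, S) = 0" if M: "M \<in> R" and S: "S \<in> F M" for M S
      using F_ind[OF M, of "\<lambda>S. c (M, S)"] s0[OF M] S by (simp add: s_def)
    then show False using c(1) by auto
  qed
  moreover have "card J < card (double_cosets G H H)"
    unfolding J_def using finD HD by (rule card_Diff1_less)
  moreover have "card \<M> \<le> card (Sigma R F)"
  proof -
    \<comment> \<open>The fibres of \<open>rep\<close> are the conjugacy classes within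
      \<open>\<M>\<close>; each consists of conjugates of its representative that contain
      \<open>H\<close>.\<close>
    have "\<M> = (\<Union>M\<in>R. {K \<in> \<M>. rep K = M})" by (auto simp: R_def)
    then have "card \<M> \<le> (\<Sum>M\<in>R. card {K \<in> \<M>. rep K = M})"
      using card_UN_le[OF finR, of "\<lambda>M. {K \<in> \<M>. rep K = M}"] by simp
    also have "\<dots> \<le> (\<Sum>M\<in>R. card (F M))"
    proof (rule sum_mono)
      fix M assume M: "M \<in> R"
      have Mc: "M \<subseteq> carrier G" using M R\<M> sub by blast
      have "finite {K. conjugate K M \<and> H \<subseteq> K}"
      proof (rule finite_subset)
        show "{K. conjugate K M \<and> H \<subseteq> K} \<subseteq> Pow (carrier G)"
          using Mc by (auto simp: conjugate_def)
      qed (use fin in simp)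
      moreover have "{K \<in> \<M>. rep K = M} \<subseteq> {K. conjugate K M \<and> H \<subseteq> K}"
        using rep sub(4) by auto
      ultimately have "card {K \<in> \<M>. rep K = M} \<le> card {K. conjugate K M \<and> H \<subseteq> K}"
        by (rule card_mono)
      also have "\<dots> \<le> card (F M)" by (rule cardF[OF M])
      finally show "card {K \<in> \<M>. rep K = M} \<le> card (F M)" .
    qed
    also have "\<dots> = card (Sigma R F)" using finR finF by simp
    finally show ?thesis .
  qed
  ultimately show ?thesis unfolding \<M>_def by linarith
qed

end
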